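(* Let $\sigma\in(0,1)$ and let $\delta_0>0$ be an associated constant such that for every $P\in\mathbb{S}^n$ with $\Vert P-P^*\Vert_F<\delta_0$, $\mathscr{R}(P)$ is invertible, $\mathcal{A}(\mathscr{K}(P))$ is stable and $\Vert \mathcal{L}^{-1}_{\mathcal{A}(\mathscr{K}(P))}(-S-\mathscr{K}(P)^TR\mathscr{K}(P))-P^*\Vert_F\le\sigma\Vert P-P^*\Vert_F$. Then there exist $\delta_1=\delta_1(\delta_0)>0$ and $c_3=c_3(\delta_0)>0$ such that, if $\Vert\Delta G\Vert_\infty<\delta_1$ and $\Vert\tilde P_0-P^*\Vert_F<\delta_0$, the inexact policy iteration initialized by $\tilde P_0\in\mathbb{S}^n$ (that is, $\hat K_1=\mathscr{K}(\tilde P_0)$, $\Delta G_0=0$) satisfies: (i) $[\hat G_i]_{uu}$ is invertible and $\hat K_i$ is stabilizing for all integers $i>0$; (ii) the system generating $\{\tilde P_i\}$, with state $\tilde P_i$, input $\Delta G_i$ and equilibrium $P^*$, is locally input-to-state stable: $$\Vert\tilde P_i-P^*\Vert_F\le\beta(\Vert\tilde P_0-P^*\Vert_F,i)+\gamma(\Vert\Delta G\Vert_\infty)\quad\text{for all } i\in\mathbb{Z}_+,$$ where $\beta(y,i)=\sigma^iy$ and $\gamma(y)=c_3y/(1-\sigma)$; (iii) $\Vert\hat K_i\Vert_F<\kappa_1$ for some $\kappa_1\in\mathbb{R}_+$, for all integers $i>0$; (iv) $\lim_{i\to\infty}\Vert\Delta G_i\Vert_F=0$ implies $\lim_{i\to\infty}\Vert\tilde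 P_i-P^*\Vert_F=0$.
   Context: $\mathbb{Z}_+$ and $\mathbb{R}_+$ are the nonnegative integers and reals, $\mathbb{S}^n$ the real symmetric $n\times n$ matrices, $\Vert\cdot\Vert_F$ the Frobenius norm. $A\in\mathbb{R}^{n\times n}$, $B\in\mathbb{R}^{n\times m}$ with $(A,B)$ controllable; $S\in\mathbb{S}^n$ is positive semidefinite with $(A,S^{1/2})$ observable; $R\in\mathbb{S}^m$ is positive definite. A square matrix is stable if its spectral radius is $<1$; $K\in\mathbb{R}^{m\times n}$ is stabilizing if $A-BK$ is stable. $P^*$ is the unique positive definite solution of $A^TPA-P-A^TPB(R+B^TPB)^{-1}B^TPA+S=0$. For $X,Y\in\mathbb{R}^{n\times n}$: $\mathcal{L}_X(Y)=X^TYX-Y$ (invertible on $\mathbb{R}^{n\times n}$ when $X$ is stable); $\mathscr{R}(Y)=R+B^TYB$; $\mathscr{K}(Y)=\mathscr{R}(Y)^{-1}B^TYA$; $\mathcal{A}(\mathscr{K}(Y))=A-B\mathscr{K}(Y)$. For $P\in\mathbb{S}^n$ let $G(P)=\begin{bmatrix} S+A^TPA-P & A^TPB\\ B^TPA & R+B^TPB\end{bmatrix}$; for $G\in\mathbb{S}^{n+m}$, $[G]_{ux}$ is its lower-left $m\times n$ block and $[G]_{uu}$ its lower-right $m\times m$ block. Inexact policy iteration initialized by $\tilde P_0$: $\hat K_1=\mathscr{K}(\tilde P_0)$, $\Delta G_0=0$, $\Delta G_i\in\mathbb{S}^{m+n}$ arbitrary for $i\ge1$. For $i=1,2,\dots$: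 $\tilde P_i\in\mathbb{S}^n$ is the solution of $(A-B\hat K_i)^T\tilde P_i(A-B\hat K_i)-\tilde P_i+S+\hat K_i^TR\hat K_i=0$ (unique when $\hat K_i$ is stabilizing), $\hat G_i=G(\tilde P_i)+\Delta G_i$, $\hat K_{i+1}=[\hat G_i]_{uu}^{-1}[\hat G_i]_{ux}$. $\Vert\Delta G\Vert_\infty=\sup_i\Vert\Delta G_i\Vert_F$. Local input-to-state stability of $x_{k+1}=f(x_k,u_k)$ at an equilibrium $x^*$ (of the zero-input system): there exist $\alpha_1,\alpha_2>0$, $\beta$ of class $\mathcal{KL}$ and $\gamma$ of class $\mathcal{K}$ such that $\Vert x_k-x^*\Vert\le\beta(\Vert x_0-x^*\Vert,k)+\gamma(\Vert u\Vert_\infty)$ for all $k$ whenever $\Vert x_0-x^*\Vert<\alpha_1$ and $\Vert u\Vert_\infty<\alpha_2$. Here $\gamma:\mathbb{R}_+\to\mathbb{R}_+$ is of class $\mathcal{K}$ if continuous, strictly increasing and $\gamma(0)=0$; $\beta:\mathbb{R}_+\times\mathbb{R}_+\to\mathbb{R}_+$ is of class $\mathcal{KL}$ if $\beta(\cdot,t)$ is of class $\mathcal{K}$ for each $t$ and $\beta(r,t)$ decreases to $0$ as $t\to\infty$ for each $r$. *)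

theory Defs
  imports "HOL-Analysis.Analysis"
begin

section \<open>Matrices\<close>

text \<open>The type \<open>real^'n^'m\<close> consists of the matrices with rows indexed by \<open>'m\<close> and columns
  indexed by \<open>'n\<close>. Its library norm is the Frobenius norm:\<close>

lemma norm_matrix_frobenius:
  fixes X :: "real^'n^'m"
  shows "norm X = sqrt (\<Sum>i\<in>UNIV. \<Sum>j\<in>UNIV. (X $ i $ j)\<^sup>2)"
  by (simp add: norm_vec_def L2_set_def sum_nonneg)

definition sym_mat :: "real^'n^'n \<Rightarrow> bool" where
  "sym_mat X \<longleftrightarrow> transpose X = X"

definition psd :: "real^'n^'n \<Rightarrow> bool" where
  "psd X \<longleftrightarrow> sym_mat X \<and> (\<forall>x. 0 \<le> x \<bullet> (X *v x))"

definition pd :: "real^'n^'n \<Rightarrow> bool" where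
  "pd X \<longleftrightarrow> sym_mat X \<and> (\<forall>x. x \<noteq> 0 \<longrightarrow> 0 < x \<bullet> (X *v x))"

definition psd_sqrt :: "real^'n^'n \<Rightarrow> real^'n^'n" where
  "psd_sqrt X = (THE Q. psd Q \<and> Q ** Q = X)"

primrec mat_pow :: "real^'n^'n \<Rightarrow> nat \<Rightarrow> real^'n^'n" where
  "mat_pow X 0 = mat 1"
| "mat_pow X (Suc k) = X ** mat_pow X k"

definition spectral_radius :: "real^'n^'n \<Rightarrow> real" where
  "spectral_radius X =
     Max {cmod z |z. \<exists>v::complex^'n. v \<noteq> 0 \<and> (\<chi> i j. complex_of_real (X $ i $ j)) *v v = z *s v}"

definition stable_mat :: "real^'n^'n \<Rightarrow> bool" where
  "stable_mat X \<longleftrightarrow> spectral_radius X < 1"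

section \<open>Linear systems\<close>

text \<open>Kalman rank conditions. The columns of the controllability matrix
  \<open>[B, A B, \<dots>, A\<^sup>n\<^sup>-\<^sup>1 B]\<close> are those of its blocks, so the dimension below is its column rank;
  dually for the rows of the observability matrix.\<close>

definition controllable :: "real^'n^'n \<Rightarrow> real^'m^'n \<Rightarrow> bool" where
  "controllable A B \<longleftrightarrow> dim (\<Union>k<CARD('n). columns (mat_pow A k ** B)) = CARD('n)"

definition observable :: "real^'n^'n \<Rightarrow> real^'n^'p \<Rightarrow> bool" where
  "observable A C \<longleftrightarrow> dim (\<Union>k<CARD('n). rows (C ** mat_pow A k)) = CARD('n)"

definition stabilizing :: "real^'n^'n \<Rightarrow> real^'m^'n \<Rightarrow> real^'n^'m \<Rightarrow> bool" where
  "stabilizing A B K \<longleftrightarrow> stable_mat (A - B ** K)"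

section \<open>Operators of the linear quadratic regulator problem\<close>

definition lyap_op :: "real^'n^'n \<Rightarrow> real^'n^'n \<Rightarrow> real^'n^'n" where
  "lyap_op X Y = transpose X ** Y ** X - Y"

definition R_op :: "real^'m^'n \<Rightarrow> real^'m^'m \<Rightarrow> real^'n^'n \<Rightarrow> real^'m^'m" where
  "R_op B R Y = R + transpose B ** Y ** B"

definition K_op :: "real^'n^'n \<Rightarrow> real^'m^'n \<Rightarrow> real^'m^'m \<Rightarrow> real^'n^'n \<Rightarrow> real^'n^'m" where
  "K_op A B R Y = matrix_inv (R_op B R Y) ** transpose B ** Y ** A"

definition closed_loop :: "real^'n^'n \<Rightarrow> real^'m^'n \<Rightarrow> real^'n^'m \<Rightarrow> real^'n^'n" where
  "closed_loop A B K = A - B ** K"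

definition riccati ::
  "real^'n^'n \<Rightarrow> real^'m^'n \<Rightarrow> real^'n^'n \<Rightarrow> real^'m^'m \<Rightarrow> real^'n^'n \<Rightarrow> real^'n^'n" where
  "riccati A B S R P =
     transpose A ** P ** A - P
     - transpose A ** P ** B ** matrix_inv (R + transpose B ** P ** B) ** transpose B ** P ** A
     + S"

section \<open>Block matrices\<close>

definition block_matrix ::
  "real^'n^'n \<Rightarrow> real^'m^'n \<Rightarrow> real^'n^'m \<Rightarrow> real^'m^'m \<Rightarrow> real^('n::finite + 'm::finite)^('n::finite + 'm::finite)" where
  "block_matrix X Y Z W = (\<chi> i j.
     (case i of
        Inl a \<Rightarrow> (case j of Inl b \<Rightarrow> X $ a $ b | Inr b \<Rightarrow> Y $ a $ b)
      | Inr a \<Rightarrow> (case j of Inl b \<Rightarrow> Z $ a $ b | Inr b \<Rightarrow> W $ a $ b)))"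

definition block_ux :: "real^('n::finite + 'm::finite)^('n::finite + 'm::finite) \<Rightarrow> real^'n^'m" where
  "block_ux G = (\<chi> i j. G $ Inr i $ Inl j)"

definition block_uu :: "real^('n::finite + 'm::finite)^('n::finite + 'm::finite) \<Rightarrow> real^'m^'m" where
  "block_uu G = (\<chi> i j. G $ Inr i $ Inr j)"

definition G_op ::
  "real^'n^'n \<Rightarrow> real^'m^'n \<Rightarrow> real^'n^'n \<Rightarrow> real^'m^'m \<Rightarrow> real^'n^'n \<Rightarrow>
   real^('n::finite + 'm::finite)^('n::finite + 'm::finite)" where
  "G_op A B S R P = block_matrix
     (S + transpose A ** P ** A - P) (transpose A ** P ** B)
     (transpose B ** P ** A)         (R + transpose B ** P ** B)"

section \<open>Inexact policy iteration\<close>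

text \<open>The solution of the Lyapunov equation is unique when \<open>K\<close> is stabilizing; otherwise the
  value of \<open>policy_value\<close> carries no information. Likewise \<open>policy_gain\<close> is meaningful when
  \<open>block_uu G\<close> is invertible. Hence the iteration below is a total function, defined also for
  data for which it would break down.\<close>

definition policy_value ::
  "real^'n^'n \<Rightarrow> real^'m^'n \<Rightarrow> real^'n^'n \<Rightarrow> real^'m^'m \<Rightarrow> real^'n^'m \<Rightarrow> real^'n^'n" where
  "policy_value A B S R K = (THE P. sym_mat P \<and>
     transpose (A - B ** K) ** P ** (A - B ** K) - P + S + transpose K ** R ** K = 0)"

definition policy_gain :: "real^('n::finite + 'm::finite)^('n::finite + 'm::finite) \<Rightarrow> real^'n^'m" where
  "policy_gain G = matrix_inv (block_uu G) ** block_ux G"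

text \<open>The iterates depend on the initial matrix \<open>P0\<close> and the disturbance sequence \<open>D\<close>. The gain
  has indices \<open>i \<ge> 1\<close>; its value at \<open>0\<close> is never used.\<close>

fun K_hat ::
  "real^'n^'n \<Rightarrow> real^'m^'n \<Rightarrow> real^'n^'n \<Rightarrow> real^'m^'m \<Rightarrow> real^'n^'n \<Rightarrow>
   (nat \<Rightarrow> real^('n::finite + 'm::finite)^('n::finite + 'm::finite)) \<Rightarrow> nat \<Rightarrow> real^'n^'m" where
  "K_hat A B S R P0 D 0 = 0"
| "K_hat A B S R P0 D (Suc 0) = K_op A B R P0"
| "K_hat A B S R P0 D (Suc (Suc i)) =
     policy_gain (G_op A B S R (policy_value A B S R (K_hat A B S R P0 D (Suc i))) + D (Suc i))"

definition P_tilde ::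
  "real^'n^'n \<Rightarrow> real^'m^'n \<Rightarrow> real^'n^'n \<Rightarrow> real^'m^'m \<Rightarrow> real^'n^'n \<Rightarrow>
   (nat \<Rightarrow> real^('n::finite + 'm::finite)^('n::finite + 'm::finite)) \<Rightarrow> nat \<Rightarrow> real^'n^'n" where
  "P_tilde A B S R P0 D i =
     (if i = 0 then P0 else policy_value A B S R (K_hat A B S R P0 D i))"

definition G_hat ::
  "real^'n^'n \<Rightarrow> real^'m^'n \<Rightarrow> real^'n^'n \<Rightarrow> real^'m^'m \<Rightarrow> real^'n^'n \<Rightarrow>
   (nat \<Rightarrow> real^('n::finite + 'm::finite)^('n::finite + 'm::finite)) \<Rightarrow> nat \<Rightarrow> real^('n::finite + 'm::finite)^('n::finite + 'm::finite)" where
  "G_hat A B S R P0 D i = G_op A B S R (P_tilde A B S R P0 D i) + D i"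

definition pi_step ::
  "real^'n^'n \<Rightarrow> real^'m^'n \<Rightarrow> real^'n^'n \<Rightarrow> real^'m^'m \<Rightarrow> real^'n^'n \<Rightarrow>
   real^('n::finite + 'm::finite)^('n::finite + 'm::finite) \<Rightarrow> real^'n^'n" where
  "pi_step A B S R P E = policy_value A B S R (policy_gain (G_op A B S R P + E))"

lemma policy_gain_G_op: "policy_gain (G_op A B S R P) = K_op A B R P"
proof -
  have "block_uu (G_op A B S R P) = R_op B R P"
    by (simp add: block_uu_def G_op_def block_matrix_def R_op_def vec_eq_iff)
  moreover have "block_ux (G_op A B S R P) = transpose B ** P ** A"
    by (simp add: block_ux_def G_op_def block_matrix_def vec_eq_iff)
  ultimately show ?thesis
    by (simp add: policy_gain_def K_op_def matrix_mul_assoc)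
qed

text \<open>\<open>pi_step\<close> is the transition map of the system generating \<open>P_tilde\<close>:\<close>

lemma P_tilde_Suc:
  assumes "D 0 = 0"
  shows "P_tilde A B S R P0 D (Suc i) = pi_step A B S R (P_tilde A B S R P0 D i) (D i)"
  using assms by (cases i) (simp_all add: P_tilde_def pi_step_def policy_gain_G_op)

section \<open>Local input-to-state stability\<close>

definition sup_norm :: "(nat \<Rightarrow> 'a::real_normed_vector) \<Rightarrow> real" where
  "sup_norm u = (SUP i. norm (u i))"

text \<open>Functions on the nonnegative reals are represented by functions on the reals of which only
  the values at nonnegative arguments matter. Nonnegativity of the values is implied.\<close>

definition class_K :: "(real \<Rightarrow> real) \<Rightarrow> bool" where
  "class_K \<gamma> \<longleftrightarrow> continuous_on {0..} \<gamma> \<and> strict_mono_on {0..} \<gamma> \<and> \<gamma> 0 = 0"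

text \<open>``Decreases to \<open>0\<close>'' is non-strict, since \<open>\<beta> 0 t = 0\<close> for all \<open>t\<close>.\<close>

definition class_KL :: "(real \<Rightarrow> real \<Rightarrow> real) \<Rightarrow> bool" where
  "class_KL \<beta> \<longleftrightarrow>
     (\<forall>t\<ge>0. class_K (\<lambda>r. \<beta> r t)) \<and>
     (\<forall>r\<ge>0. antimono_on {0..} (\<beta> r) \<and> (\<beta> r \<longlongrightarrow> 0) at_top)"

text \<open>The system is \<open>x (Suc k) = f (x k) (u k)\<close> with states in \<open>X\<close> and inputs in \<open>U\<close>. A bound on
  \<open>sup_norm u\<close> is understood to entail that the supremum is finite, which is stated as
  boundedness of \<open>u\<close>.\<close>

definition locally_ISS_with ::
  "('x::real_normed_vector \<Rightarrow> 'u::real_normed_vector \<Rightarrow> 'x) \<Rightarrow> 'x set \<Rightarrow> 'u set \<Rightarrow> 'x \<Rightarrow>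
   (real \<Rightarrow> real \<Rightarrow> real) \<Rightarrow> (real \<Rightarrow> real) \<Rightarrow> bool" where
  "locally_ISS_with f X U xs \<beta> \<gamma> \<longleftrightarrow>
     xs \<in> X \<and> f xs 0 = xs \<and> class_KL \<beta> \<and> class_K \<gamma> \<and>
     (\<exists>\<alpha>1>0. \<exists>\<alpha>2>0. \<forall>x u.
        x 0 \<in> X \<and> range u \<subseteq> U \<and> (\<forall>k. x (Suc k) = f (x k) (u k)) \<and>
        norm (x 0 - xs) < \<alpha>1 \<and> bounded (range u) \<and> sup_norm u < \<alpha>2 \<longrightarrow>
        (\<forall>k. norm (x k - xs) \<le> \<beta> (norm (x 0 - xs)) (real k) + \<gamma> (sup_norm u)))"

end

theory Submission
  imports Defs "HOL-Computational_Algebra.Fundamental_Theorem_Algebra"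
begin

text \<open>The undisturbed iteration contracts distances to \<open>Pstar\<close> by the factor \<open>\<sigma>\<close> on the ball of radius \<open>\<delta>0\<close>;
  the disturbed one is treated as a perturbation of it. If one disturbed step satisfies
  \<open>norm (P (i + 1) - Pstar) \<le> \<sigma> * norm (P i - Pstar) + c * norm (\<Delta>G i)\<close>,
  then unrolling the recursion gives the input-to-state estimate, and vanishing disturbances give
  convergence (\<open>perturbed_contraction_bound\<close>, \<open>perturbed_contraction_tendsto_0\<close>). All the work is in
  finding \<open>c\<close> independently of the state.

  Such a \<open>c\<close> comes from compactness. The initial matrix lies in an open ball, but \<open>\<Delta>G 0 = 0\<close>, so
  the next iterate already lies in the closed ball of radius \<open>\<sigma> \<delta>0\<close>, and small disturbances cannot drive
  the later ones out of it. On this compact set both halves of a step solve a linear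
  equation with an injective operator: \<open>R_op B R P ** K = B\<^sup>T P A\<close> determines the gain, and the Lyapunov
  equation determines the next iterate. An injective linear map that depends continuously on
  a parameter in a compact set is uniformly bounded below (\<open>uniform_lower_bound\<close>), which makes the solutions Lipschitz
  in the data (\<open>lipschitz_policy_gain\<close>, \<open>lipschitz_policy_value\<close>).

  The same device shows that gains near stabilizing gains are stabilizing
  (\<open>uniformly_stabilizing\<close>), once stability of \<open>X\<close> is expressed as injectivity of \<open>1 - w X\<close> for all
  complex \<open>w\<close> in the closed unit disc. The link between the spectral radius and the
  Lyapunov operator is \<open>lyap_op_injective\<close>; it rests on eigenvectors obtained from
  a polynomial that annihilates the matrix.\<close>

section \<open>Matrix algebra\<close>

lemma mat_mul_nth [simp]: "(mat c ** Y) $ i $ j = c * Y $ i $ j"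
  for Y :: "'a::comm_semiring_1^'n^'m"
proof -
  have "(mat c ** Y) $ i $ j = (\<Sum>k\<in>UNIV. if i = k then c * Y $ k $ j else 0)"
    by (simp add: matrix_matrix_mult_def mat_def if_distrib[of "\<lambda>x. x * _"] cong: if_cong)
  then show ?thesis by simp
qed

lemma mat_commute: "M ** (mat c ** Y) = mat c ** (M ** Y)"
  for Y :: "'a::comm_semiring_1^'n^'m"
proof -
  have "(M ** (mat c ** Y)) $ i $ j = (mat c ** (M ** Y)) $ i $ j" for i j
    unfolding mat_mul_nth matrix_matrix_mult_def[of M] by (simp add: sum_distrib_left algebra_simps)
  then show ?thesis by (simp add: vec_eq_iff)
qed

lemma mat_mul_eq_0: "mat c ** Y = 0 \<longleftrightarrow> c = 0 \<or> Y = 0" for Y :: "'a::field^'n^'m"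
  by (auto simp: vec_eq_iff)

lemma mat_add: "mat (a + b) = mat a + (mat b :: 'a::comm_ring_1^'n^'n)"
  by (simp add: vec_eq_iff mat_def)

lemma mat_1_neq_0: "mat 1 \<noteq> (0 :: 'a::zero_neq_one^'n^'n)"
  by (simp add: vec_eq_iff mat_def)

lemma matrix_add_rdistrib: "(B + C) ** A = B ** A + C ** A"
  for A :: "'a::ring_1^'n^'m"
  by (simp add: vec_eq_iff matrix_matrix_mult_def distrib_right sum.distrib)

lemma matrix_diff_ldistrib: "A ** (B - C) = A ** B - A ** C"
  for A :: "'a::ring_1^'n^'m"
  by (simp add: vec_eq_iff matrix_matrix_mult_def right_diff_distrib sum_subtractf)

lemma matrix_diff_rdistrib: "(B - C) ** A = B ** A - C ** A"
  for A :: "'a::ring_1^'n^'m"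
  by (simp add: vec_eq_iff matrix_matrix_mult_def left_diff_distrib sum_subtractf)

lemma transpose_diff: "transpose (X - Y) = transpose X - transpose Y"
  by (simp add: vec_eq_iff transpose_def)

lemma matrix_inv_right: "invertible M \<Longrightarrow> M ** (matrix_inv M ** N) = N"
  for M :: "real^'n^'n"
proof -
  assume "invertible M"
  then have "M ** matrix_inv M = mat 1"
    unfolding matrix_inv_def invertible_def by (rule someI2_ex) simp
  then show ?thesis by (simp add: matrix_mul_assoc)
qed

section \<open>Eigenvalues and stability\<close>

abbreviation of_real_mat :: "real^'n^'m \<Rightarrow> complex^'n^'m" where
  "of_real_mat X \<equiv> (\<chi> i j. complex_of_real (X $ i $ j))"

definition eigenvalue :: "complex^'n^'n \<Rightarrow> complex \<Rightarrow> bool" where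
  "eigenvalue M z \<longleftrightarrow> (\<exists>v. v \<noteq> 0 \<and> M *v v = z *s v)"

text \<open>The value \<open>p(M)\<close>, by Horner's scheme, which makes induction over \<open>pCons\<close> immediate.\<close>

definition poly_mat :: "complex^'n^'n \<Rightarrow> complex poly \<Rightarrow> complex^'n^'n" where
  "poly_mat M p = foldr (\<lambda>a Y. mat a + M ** Y) (coeffs p) 0"

lemma poly_mat_0 [simp]: "poly_mat M 0 = 0"
  by (simp add: poly_mat_def)

lemma poly_mat_pCons [simp]: "poly_mat M (pCons a p) = mat a + M ** poly_mat M p"
  by (cases "a = 0 \<and> p = 0") (auto simp: poly_mat_def cCons_def)

lemma poly_mat_add: "poly_mat M (p + q) = poly_mat M p + poly_mat M q"
  by (induction p q rule: poly_induct2) (simp_all add: mat_add matrix_add_ldistrib)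

lemma poly_mat_smult: "poly_mat M (smult c p) = mat c ** poly_mat M p"
proof (induction p)
  case (pCons a p)
  have "mat (c * a) = mat c ** (mat a :: complex^'n^'n)"
    by (simp add: vec_eq_iff) (simp add: mat_def)
  with pCons show ?case
    by (simp add: matrix_add_ldistrib mat_commute)
qed simp

lemma poly_mat_linear_factor:
  "poly_mat M ([:-z, 1:] * q) = M ** poly_mat M q - mat z ** poly_mat M q"
proof -
  have "mat (- z) ** Y = - (mat z ** Y)" for Y :: "complex^'n^'n"
    by (simp add: vec_eq_iff)
  then show ?thesis
    using poly_mat_add[of M "smult (-z) q" "pCons 0 q"] poly_mat_smult[of M "-z" q] by simp
qed

lemma poly_mat_commute: "M ** poly_mat M p = poly_mat M p ** M"
proof (induction p)
  case (pCons a p)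
  have "M ** mat a = mat a ** M"
    using mat_commute[of M a "mat 1"] by simp
  with pCons show ?case
    by (simp add: matrix_add_ldistrib matrix_add_rdistrib) (metis matrix_mul_assoc)
qed simp

lemma poly_mat_sum: "poly_mat M (sum f S) = (\<Sum>k\<in>S. poly_mat M (f k))"
  by (induction S rule: infinite_finite_induct) (simp_all add: poly_mat_add)

text \<open>The powers of \<open>M\<close> lie in a finite-dimensional real space, so finitely many of them are linearly
  dependent, already with real coefficients. One annihilating polynomial serves for everything that
  follows: the eigenvalues of \<open>M\<close> are among its roots, and splitting it into linear factors produces
  eigenvectors.\<close>

lemma exists_annihilating_poly:
  fixes M :: "complex^'n^'n"
  obtains p where "p \<noteq> 0" "poly_mat M p = 0"
proof -
  define pw where "pw k = poly_mat M (monom 1 k)" for k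
  define N where "N = DIM(complex^'n^'n)"
  show thesis
  proof (cases "inj_on pw {..N}")
    case False
    then obtain a b where ab: "a \<noteq> b" "pw a = pw b"
      by (auto simp: inj_on_def)
    have "monom 1 a + smult (-1) (monom 1 b) \<noteq> (0::complex poly)"
    proof
      assume "monom 1 a + smult (-1) (monom 1 b) = (0::complex poly)"
      then have "coeff (monom 1 a + smult (-1) (monom 1 b)) a = (0::complex)"
        by simp
      with ab show False by simp
    qed
    moreover have "poly_mat M (monom 1 a + smult (-1) (monom 1 b)) = 0"
      using ab(2) unfolding poly_mat_add poly_mat_smult pw_def by (simp add: vec_eq_iff)
    ultimately show thesis by (rule that)
  next
    case True
    then have "dependent (pw ` {..N})"
      by (intro dependent_biggerset) (simp add: card_image N_def)
    then obtain u v where u: "v \<in> pw ` {..N}" "u v \<noteq> 0" "(\<Sum>w\<in>pw ` {..N}. u w *\<^sub>R w) = 0"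
      by (auto simp: dependent_finite)
    then obtain k where k: "k \<le> N" "u (pw k) \<noteq> 0"
      by auto
    define p where "p = (\<Sum>j\<le>N. smult (complex_of_real (u (pw j))) (monom 1 j))"
    have "coeff p k = (\<Sum>j\<le>N. if j = k then complex_of_real (u (pw j)) else 0)"
      unfolding p_def coeff_sum by (intro sum.cong) auto
    with k have "coeff p k \<noteq> 0" by simp
    then have "p \<noteq> 0" by auto
    moreover
    have "mat (complex_of_real c) ** Y = c *\<^sub>R Y" for c and Y :: "complex^'n^'n"
      by (simp add: vec_eq_iff scaleR_conv_of_real[where 'a = complex])
    then have "poly_mat M p = (\<Sum>j\<le>N. u (pw j) *\<^sub>R pw j)"
      unfolding p_def poly_mat_sum poly_mat_smult pw_def by simp
    then have "poly_mat M p = 0"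
      using u(3) by (simp add: sum.reindex[OF True])
    ultimately show thesis by (rule that)
  qed
qed

text \<open>Strip linear factors \<open>M - z\<close> off \<open>p(M)\<close> until the product with \<open>Y\<close> is nonzero for the first
  time: the last factor stripped annihilates what is left. That the result has the form \<open>q(M) Y\<close>
  matters below, because left multiplication by \<open>q(M)\<close> preserves the solutions of every homogeneous linear
  equation whose solutions are preserved by left multiplication by \<open>M\<close>.\<close>

lemma eigenmatrix_in_orbit:
  assumes "p \<noteq> 0" "poly_mat M p ** Y = 0" "Y \<noteq> 0"
  shows "\<exists>q z. poly_mat M q ** Y \<noteq> 0 \<and>
           M ** (poly_mat M q ** Y) = mat z ** (poly_mat M q ** Y)"
  using assms
proof (induction "degree p" arbitrary: p)
  case 0
  then obtain c where "p = [:c:]"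
    using degree_eq_zeroE by metis
  with 0 show ?case by (simp add: mat_mul_eq_0)
next
  case (Suc d)
  then obtain z where z: "poly p z = 0"
    using fundamental_theorem_of_algebra[of p] constant_degree[of p] by auto
  then obtain q where q: "p = [:-z, 1:] * q"
    by (metis poly_eq_0_iff_dvd dvdE)
  with Suc.prems have "q \<noteq> 0" by auto
  then have "degree p = Suc (degree q)"
    unfolding q by (subst degree_mult_eq) auto
  with Suc.hyps(2) have d: "d = degree q" by simp
  show ?case
  proof (cases "poly_mat M q ** Y = 0")
    case True
    then show ?thesis using Suc.hyps(1) d \<open>q \<noteq> 0\<close> Suc.prems by blast
  next
    case False
    moreover have "M ** (poly_mat M q ** Y) = mat z ** (poly_mat M q ** Y)"
      using Suc.prems(2) unfolding q poly_mat_linear_factor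
      by (simp add: matrix_diff_rdistrib matrix_mul_assoc)
    ultimately show ?thesis by blast
  qed
qed

lemma matrix_eq_0_column: "Y \<noteq> 0 \<Longrightarrow> \<exists>j. column j Y \<noteq> 0"
  by (auto simp: vec_eq_iff column_def)

lemma eigenvalue_of_eigenmatrix:
  assumes "M ** Y = mat z ** Y" "Y \<noteq> 0"
  shows "eigenvalue M z"
proof -
  obtain j where j: "column j Y \<noteq> 0"
    using assms(2) matrix_eq_0_column by blast
  have "(M ** Y) $ i $ j = (mat z ** Y) $ i $ j" for i
    using assms(1) by simp
  then have "M *v column j Y = z *s column j Y"
    by (simp add: vec_eq_iff column_def matrix_vector_mult_def) (simp add: matrix_matrix_mult_def)
  with j show ?thesis by (auto simp: eigenvalue_def)
qed

lemma poly_mat_eigenvector: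
  assumes "M *v v = z *s v"
  shows "poly_mat M p *v v = poly p z *s v"
proof (induction p)
  case (pCons a p)
  have "mat a *v v = a *s v"
    by (simp add: vec_eq_iff matrix_vector_mult_def mat_def if_distrib[of "\<lambda>x. x * _"] cong: if_cong)
  moreover have "M *v (c *s v) = c *s (M *v v)" for c
    by (simp add: vec_eq_iff matrix_vector_mult_def sum_distrib_left algebra_simps)
  ultimately show ?case
    using pCons assms
    by (simp add: matrix_vector_mult_add_rdistrib vector_sadd_rdistrib mult.commute
        flip: matrix_vector_mul_assoc)
qed simp

lemma finite_eigenvalues: "finite {z. eigenvalue M z}"
proof -
  obtain p where p: "p \<noteq> 0" "poly_mat M p = 0"
    by (rule exists_annihilating_poly)
  have "{z. eigenvalue M z} \<subseteq> {z. poly p z = 0}"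
  proof clarify
    fix z assume "eigenvalue M z"
    then obtain v where v: "v \<noteq> 0" "M *v v = z *s v" by (auto simp: eigenvalue_def)
    with poly_mat_eigenvector[OF v(2), of p] p(2) show "poly p z = 0" by simp
  qed
  then show ?thesis
    using poly_roots_finite[OF p(1)] finite_subset by blast
qed

lemma exists_eigenvalue: "\<exists>z. eigenvalue M z"
proof -
  obtain p where "p \<noteq> 0" "poly_mat M p = 0"
    by (rule exists_annihilating_poly)
  then show ?thesis
    using eigenmatrix_in_orbit[of p M "mat 1"] eigenvalue_of_eigenmatrix mat_1_neq_0 by fastforce
qed

text \<open>The spectral radius is a maximum, whose value is determined by its defining set only if that set is
  finite and nonempty; both facts are needed to read off a bound on all eigenvalues.\<close>

lemma stable_mat_iff: "stable_mat X \<longleftrightarrow> (\<forall>z. eigenvalue (of_real_mat X) z \<longrightarrow> cmod z < 1)"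
proof -
  have *: "{cmod z |z. \<exists>v. v \<noteq> 0 \<and> of_real_mat X *v v = z *s v} = cmod ` {z. eigenvalue (of_real_mat X) z}"
    by (auto simp: eigenvalue_def)
  show ?thesis
    unfolding stable_mat_def spectral_radius_def *
    using exists_eigenvalue[of "of_real_mat X"]
    by (subst Max_less_iff) (auto simp: finite_eigenvalues)
qed

lemma eigenvalue_iff_not_invertible:
  fixes M :: "complex^'n^'n"
  shows "eigenvalue M z \<longleftrightarrow> \<not> invertible (M - mat z)"
proof -
  have "mat z *v v = z *s v" for v :: "complex^'n"
    by (simp add: vec_eq_iff matrix_vector_mult_def mat_def if_distrib[of "\<lambda>x. x * _"] cong: if_cong)
  then have "(M - mat z) *v v = 0 \<longleftrightarrow> M *v v = z *s v" for v
    unfolding matrix_vector_mult_diff_rdistrib by simp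
  then show ?thesis
    unfolding invertible_left_inverse matrix_left_invertible_ker eigenvalue_def by auto
qed

lemma eigenvalue_transpose: "eigenvalue (transpose M) z \<longleftrightarrow> eigenvalue M z"
proof -
  have "transpose M - mat z = transpose (M - mat z)"
    by (auto simp: vec_eq_iff transpose_def mat_def)
  then show ?thesis
    unfolding eigenvalue_iff_not_invertible by (metis invertible_left_inverse invertible_right_inverse left_invertible_transpose)
qed

lemma of_real_mat_mult: "of_real_mat (X ** Y) = of_real_mat X ** of_real_mat Y"
  by (simp add: vec_eq_iff matrix_matrix_mult_def)

text \<open>Suppose \<open>X\<^sup>T Y X = Y\<close> with \<open>Y \<noteq> 0\<close>. Multiplying by a suitable \<open>q(X\<^sup>T)\<close> from the left yields a
  nonzero solution \<open>W\<close> that moreover satisfies \<open>X\<^sup>T W = z W\<close>. Then \<open>z W X = W\<close>, so \<open>z\<close> is nonzero,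
  the columns of \<open>W\<close> are eigenvectors of \<open>X\<^sup>T\<close> for \<open>z\<close>, and its rows are eigenvectors of \<open>X\<^sup>T\<close> for \<open>1/z\<close>.
  These numbers cannot both have modulus below one.\<close>

lemma lyap_op_injective:
  assumes "stable_mat X" "lyap_op X Y = 0"
  shows "Y = 0"
proof (rule ccontr)
  assume "Y \<noteq> 0"
  define M where "M = of_real_mat (transpose X)"
  have MX: "M = transpose (of_real_mat X)"
    by (simp add: M_def vec_eq_iff transpose_def)
  have M: "cmod z < 1" if "eigenvalue M z" for z
    using assms(1) that unfolding stable_mat_iff MX eigenvalue_transpose by blast
  define C where "C = of_real_mat Y"
  have C0: "C \<noteq> 0" using \<open>Y \<noteq> 0\<close> by (auto simp: C_def vec_eq_iff)
  have "transpose X ** Y ** X = Y" using assms(2) by (simp add: lyap_op_def)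
  then have C: "M ** C ** of_real_mat X = C"
    unfolding C_def M_def by (metis of_real_mat_mult)
  obtain p where p: "p \<noteq> 0" "poly_mat M p = 0"
    by (rule exists_annihilating_poly)
  then obtain q z where q: "poly_mat M q ** C \<noteq> 0"
    "M ** (poly_mat M q ** C) = mat z ** (poly_mat M q ** C)"
    using eigenmatrix_in_orbit[of p M C] C0 by auto
  define W where "W = poly_mat M q ** C"
  have z: "eigenvalue M z"
    using eigenvalue_of_eigenmatrix q by blast
  have "M ** W ** of_real_mat X = poly_mat M q ** (M ** C ** of_real_mat X)"
    unfolding W_def by (simp add: matrix_mul_assoc poly_mat_commute)
  then have W: "mat z ** W ** of_real_mat X = W"
    using C q(2) by (simp add: W_def)
  have z0: "z \<noteq> 0" using W q(1) by (auto simp: W_def)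
  have "mat z ** (M ** transpose W) = transpose (mat z ** W ** of_real_mat X)"
    by (simp add: matrix_transpose_mul MX transpose_mat mat_commute flip: matrix_mul_assoc)
       (metis mat_commute matrix_mul_assoc matrix_mul_rid)
  then have "mat z ** (M ** transpose W) = transpose W"
    using W by simp
  then have "M ** transpose W = mat (1/z) ** transpose W"
    using z0 by (simp add: vec_eq_iff) (metis nonzero_eq_divide_eq mult.commute)
  moreover have "transpose W \<noteq> 0"
    using q(1) unfolding W_def[symmetric] by (auto simp: vec_eq_iff transpose_def)
  ultimately have "eigenvalue M (1/z)"
    using eigenvalue_of_eigenmatrix by blast
  from M[OF this] M[OF z] z0 show False
    by (simp add: norm_divide field_simps)
qed

section \<open>Submultiplicativity of the Frobenius norm\<close>

lemma norm_matrix_vector_mult_le: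
  fixes M :: "'a::real_normed_field^'n^'m"
  shows "norm (M *v x) \<le> norm M * norm x"
proof -
  have "norm ((M *v x) $ i) \<le> norm x * norm (M $ i)" for i
  proof -
    have "norm ((M *v x) $ i) \<le> (\<Sum>j\<in>UNIV. norm (M $ i $ j) * norm (x $ j))"
      unfolding matrix_vector_mult_def by (simp add: sum_norm_le norm_mult)
    also have "\<dots> \<le> norm (M $ i) * norm x"
      using L2_set_mult_ineq[of "\<lambda>j. norm (M $ i $ j)" "\<lambda>j. norm (x $ j)" UNIV]
      by (simp add: norm_vec_def)
    finally show ?thesis by (simp add: mult.commute)
  qed
  then have "norm (M *v x) \<le> L2_set (\<lambda>i. norm x * norm (M $ i)) UNIV"
    unfolding norm_vec_def[of "M *v x"] by (intro L2_set_mono) auto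
  also have "\<dots> = norm M * norm x"
    by (simp add: norm_vec_def[of M] mult.commute flip: L2_set_right_distrib)
  finally show ?thesis .
qed

lemma norm_matrix_transpose:
  fixes M :: "'a::real_normed_vector^'n^'m"
  shows "norm (transpose M) = norm M"
  unfolding norm_vec_def L2_set_def transpose_def
  by (simp add: sum_nonneg) (rule sum.swap)

lemma norm_matrix_mult_le:
  fixes M :: "'a::real_normed_field^'n^'m"
  shows "norm (M ** N) \<le> norm M * norm N"
proof -
  have "norm (transpose (M ** N) $ j) \<le> norm M * norm (transpose N $ j)" for j
  proof -
    have "transpose (M ** N) $ j = M *v (transpose N $ j)"
      by (simp add: vec_eq_iff transpose_def matrix_matrix_mult_def matrix_vector_mult_def)
    then show ?thesis by (simp add: norm_matrix_vector_mult_le)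
  qed
  then have "norm (transpose (M ** N)) \<le> L2_set (\<lambda>j. norm M * norm (transpose N $ j)) UNIV"
    unfolding norm_vec_def[of "transpose (M ** N)"] by (intro L2_set_mono) auto
  also have "\<dots> = norm M * norm (transpose N)"
    by (simp add: norm_vec_def[of "transpose N"] flip: L2_set_right_distrib)
  finally show ?thesis by (simp add: norm_matrix_transpose)
qed

lemma bounded_bilinear_matrix_mult:
  "bounded_bilinear ((**) :: real^'n^'m \<Rightarrow> real^'p^'n \<Rightarrow> real^'p^'m)"
proof
  show "\<exists>K. \<forall>a b. norm (a ** b :: real^'p^'m) \<le> norm (a::real^'n^'m) * norm b * K"
    by (rule exI[of _ 1]) (simp add: norm_matrix_mult_le)
qed (simp_all add: matrix_add_ldistrib matrix_add_rdistrib vec_eq_iff,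
     simp_all add: matrix_matrix_mult_def sum_distrib_left algebra_simps)

lemmas continuous_on_matrix_mult [continuous_intros] =
  bounded_bilinear.continuous_on[OF bounded_bilinear_matrix_mult]

lemma continuous_on_transpose [continuous_intros]:
  "continuous_on T f \<Longrightarrow> continuous_on T (\<lambda>x. transpose (f x))"
  for f :: "_ \<Rightarrow> real^'n^'m"
  unfolding transpose_def by (intro continuous_intros)

lemma norm_congruence_le:
  fixes X :: "real^'n^'m"
  shows "norm (transpose X ** M ** X) \<le> (norm X)\<^sup>2 * norm M"
proof -
  have "norm (transpose X ** M ** X) \<le> norm (transpose X ** M) * norm X"
    by (rule norm_matrix_mult_le)
  also have "\<dots> \<le> norm (transpose X) * norm M * norm X"
    by (intro mult_right_mono norm_matrix_mult_le) simp
  finally show ?thesis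
    by (simp add: norm_matrix_transpose power2_eq_square mult_ac)
qed

lemma norm_congruence_diff_le:
  fixes X X' :: "real^'n^'m"
  shows "norm (transpose X' ** M ** X' - transpose X ** M ** X)
    \<le> (norm X + norm X') * norm (X' - X) * norm M"
proof -
  have "transpose X' ** M ** X' - transpose X ** M ** X
    = transpose (X' - X) ** M ** X' + transpose X ** M ** (X' - X)"
    by (simp add: transpose_diff matrix_diff_ldistrib matrix_diff_rdistrib)
  also have "norm \<dots> \<le> norm (transpose (X' - X) ** M ** X') + norm (transpose X ** M ** (X' - X))"
    by (rule norm_triangle_ineq)
  also have "\<dots> \<le> norm (transpose (X' - X)) * norm M * norm X' + norm (transpose X) * norm M * norm (X' - X)"
    by (intro add_mono order_trans[OF norm_matrix_mult_le] mult_right_mono norm_matrix_mult_le) simp_all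
  finally show ?thesis
    by (simp add: norm_matrix_transpose algebra_simps)
qed

section \<open>Uniformly invertible families of linear maps\<close>

text \<open>By homogeneity it suffices to bound \<open>norm (F t y)\<close> away from \<open>0\<close> for unit vectors \<open>y\<close>, and
  on the compact set \<open>T \<times> sphere 0 1\<close> a positive continuous function attains a positive minimum. The
  lemma is used for the Hessian \<open>R_op B R P\<close>, for the Lyapunov operator, and for the
  resolvent.\<close>

lemma uniform_lower_bound:
  fixes F :: "'t::topological_space \<Rightarrow> 'a::euclidean_space \<Rightarrow> 'b::real_normed_vector"
  assumes T: "compact T" and cont: "continuous_on (T \<times> UNIV) (\<lambda>(t, y). F t y)"
    and lin: "\<And>t. t \<in> T \<Longrightarrow> linear (F t)"
    and inj: "\<And>t y. t \<in> T \<Longrightarrow> F t y = 0 \<Longrightarrow> y = 0"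
  obtains m where "m > 0" "\<And>t y. t \<in> T \<Longrightarrow> norm y \<le> m * norm (F t y)"
proof (cases "T = {}")
  case True
  then show ?thesis using that[of 1] by simp
next
  case False
  let ?S = "sphere (0::'a) 1"
  have "compact (T \<times> ?S)" "T \<times> ?S \<noteq> {}"
    using T False by (auto intro: compact_Times)
  moreover have "continuous_on (T \<times> ?S) (\<lambda>z. norm (F (fst z) (snd z)))"
    using cont by (intro continuous_on_norm) (auto intro: continuous_on_subset simp: case_prod_unfold)
  ultimately obtain z where z: "z \<in> T \<times> ?S"
    "\<And>z'. z' \<in> T \<times> ?S \<Longrightarrow> norm (F (fst z) (snd z)) \<le> norm (F (fst z') (snd z'))"
    using continuous_attains_inf[of "T \<times> ?S"] by blast
  define \<mu> where "\<mu> = norm (F (fst z) (snd z))"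
  have "\<mu> \<noteq> 0"
  proof
    assume "\<mu> = 0"
    then have "snd z = 0" using inj[of "fst z" "snd z"] z(1) by (auto simp: \<mu>_def mem_Times_iff)
    with z(1) show False by (simp add: mem_Times_iff)
  qed
  then have \<mu>: "\<mu> > 0" by (simp add: \<mu>_def)
  show ?thesis
  proof (rule that[of "1 / \<mu>"])
    fix t y assume t: "t \<in> T"
    show "norm y \<le> 1 / \<mu> * norm (F t y)"
    proof (cases "y = 0")
      case False
      then have "\<mu> \<le> norm (F t (y /\<^sub>R norm y))"
        using z(2)[of "(t, y /\<^sub>R norm y)"] t by (simp add: \<mu>_def)
      also have "\<dots> = norm (F t y) / norm y"
        using lin[OF t] by (simp add: linear_cmul divide_inverse mult.commute)
      finally show ?thesis
        using False \<mu> by (simp add: field_simps)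
    qed (use \<mu> in simp)
  qed (use \<mu> in simp)
qed

text \<open>If \<open>F y = g\<close> and \<open>(F + \<Delta>) y' = g'\<close>, then \<open>F (y' - y) = (g' - g) - \<Delta> y'\<close>, which gives the first
  hypothesis with \<open>a\<close> and \<open>b\<close> bounding \<open>\<Delta>\<close> and \<open>g' - g\<close>. When \<open>m a \<le> 1/2\<close> the unknown \<open>y'\<close> on the
  right can be absorbed, leaving a bound in terms of the unperturbed solution \<open>y\<close>.\<close>

lemma perturbed_solution_bound:
  fixes y y' :: "'a::real_normed_vector"
  assumes "norm (y' - y) \<le> m * (a * norm y' + b)" "m * a \<le> 1/2" "0 \<le> m" "0 \<le> a"
  shows "norm (y' - y) \<le> 2 * m * (a * norm y + b)"
proof -
  have "m * a * norm y' \<le> m * a * (norm y + norm (y' - y))"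
    using assms(3,4) norm_triangle_sub[of y' y] by (intro mult_left_mono) auto
  moreover have "m * a * norm (y' - y) \<le> 1/2 * norm (y' - y)"
    using assms(2) by (intro mult_right_mono) auto
  ultimately have "norm (y' - y) \<le> m * a * norm y + 1/2 * norm (y' - y) + m * b"
    using assms(1) by (simp add: algebra_simps)
  then show ?thesis by (simp add: algebra_simps)
qed

text \<open>Stability says that \<open>1 - w X\<close> is injective for all \<open>w\<close> in the closed unit disc, where
  \<open>w\<close> stands for the reciprocal of an eigenvalue of modulus at least one. In this form it is
  injectivity of a family of linear maps with a compact parameter set, which survives small perturbations.\<close>

lemma stable_mat_iff_resolvent:
  "stable_mat X \<longleftrightarrow> (\<forall>w v. cmod w \<le> 1 \<longrightarrow> v - w *s (of_real_mat X *v v) = 0 \<longrightarrow> v = 0)"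
proof
  assume X: "stable_mat X"
  show "\<forall>w v. cmod w \<le> 1 \<longrightarrow> v - w *s (of_real_mat X *v v) = 0 \<longrightarrow> v = 0"
  proof (intro allI impI, rule ccontr)
    fix w v assume w: "cmod w \<le> 1" and v: "v - w *s (of_real_mat X *v v) = 0" "v \<noteq> 0"
    then have w0: "w \<noteq> 0" by auto
    have "of_real_mat X *v v = (1 / w) *s (w *s (of_real_mat X *v v))"
      using w0 by simp
    also have "w *s (of_real_mat X *v v) = v" using v(1) by simp
    finally have "eigenvalue (of_real_mat X) (1 / w)"
      using v(2) by (auto simp: eigenvalue_def)
    then have "cmod (1 / w) < 1" using X by (simp add: stable_mat_iff)
    with w w0 show False by (simp add: norm_divide field_simps)
  qed
next
  assume *: "\<forall>w v. cmod w \<le> 1 \<longrightarrow> v - w *s (of_real_mat X *v v) = 0 \<longrightarrow> v = 0"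
  show "stable_mat X"
    unfolding stable_mat_iff
  proof (intro allI impI, rule ccontr)
    fix z assume "eigenvalue (of_real_mat X) z" and z: "\<not> cmod z < 1"
    then obtain v where v: "v \<noteq> 0" "of_real_mat X *v v = z *s v" by (auto simp: eigenvalue_def)
    from z have "z \<noteq> 0" by auto
    then have "v - (1 / z) *s (of_real_mat X *v v) = 0" using v(2) by simp
    moreover have "cmod (1 / z) \<le> 1" using z by (simp add: norm_divide divide_simps)
    ultimately show False using * v(1) by blast
  qed
qed

section \<open>The Lyapunov equation and its dependence on the gain\<close>

lemma linear_lyap_op: "linear (lyap_op X)"
  unfolding lyap_op_def
  by (rule linearI)
    (simp_all add: matrix_add_ldistrib matrix_add_rdistrib algebra_simps
      bounded_bilinear.scaleR_left[OF bounded_bilinear_matrix_mult]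
      bounded_bilinear.scaleR_right[OF bounded_bilinear_matrix_mult])

lemma bij_lyap_op:
  assumes "stable_mat X"
  shows "bij (lyap_op X)"
proof -
  have "inj (lyap_op X)"
    unfolding linear_injective_0[OF linear_lyap_op] using lyap_op_injective[OF assms] by blast
  then show ?thesis
    using linear_injective_imp_surjective[OF linear_lyap_op] by (simp add: bij_def)
qed

lemma transpose_lyap_op: "transpose (lyap_op X Y) = lyap_op X (transpose Y)"
  by (simp add: lyap_op_def transpose_diff matrix_transpose_mul matrix_mul_assoc)

lemma sym_mat_congruence: "sym_mat M \<Longrightarrow> sym_mat (transpose X ** M ** X)"
  for M :: "real^'n^'n"
  by (simp add: sym_mat_def matrix_transpose_mul matrix_mul_assoc)

text \<open>The Lyapunov equation has exactly one solution, and the transpose of a solution is again one, so the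
  solution is symmetric.\<close>

lemma policy_value_properties:
  fixes A :: "real^'n^'n" and B :: "real^'m^'n"
  assumes K: "stabilizing A B K" and S: "sym_mat S" and R: "sym_mat R"
  shows "policy_value A B S R K = inv (lyap_op (A - B ** K)) (- S - transpose K ** R ** K)"
    and "lyap_op (A - B ** K) (policy_value A B S R K) = - S - transpose K ** R ** K"
    and "sym_mat (policy_value A B S R K)"
proof -
  let ?L = "lyap_op (A - B ** K)" and ?Q = "- S - transpose K ** R ** K"
  have bij: "bij ?L"
    using K bij_lyap_op by (simp add: stabilizing_def)
  define P where "P = inv ?L ?Q"
  have P: "?L P = ?Q"
    unfolding P_def using bij by (simp add: bij_is_surj surj_f_inv_f)
  have "transpose ?Q = ?Q"
    using S sym_mat_congruence[OF R, of K] unfolding sym_mat_def transpose_diff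
    by (simp add: vec_eq_iff transpose_def)
  then have "?L (transpose P) = ?L P"
    using transpose_lyap_op[of "A - B ** K" P] P by simp
  then have sym: "sym_mat P"
    unfolding sym_mat_def using bij by (meson bij_is_inj injD)
  have eq: "transpose (A - B ** K) ** Y ** (A - B ** K) - Y + S + transpose K ** R ** K = 0
      \<longleftrightarrow> ?L Y = ?Q" for Y
    by (simp add: lyap_op_def algebra_simps eq_neg_iff_add_eq_0)
  have "policy_value A B S R K = P"
    unfolding policy_value_def eq
  proof (rule the_equality)
    show "sym_mat P \<and> ?L P = ?Q" using sym P by simp
    show "Y = P" if "sym_mat Y \<and> ?L Y = ?Q" for Y
      using that P bij by (metis bij_is_inj injD)
  qed
  then show "policy_value A B S R K = inv ?L ?Q" "?L (policy_value A B S R K) = ?Q"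
    "sym_mat (policy_value A B S R K)"
    using sym P by (simp_all add: P_def)
qed

text \<open>A compact set of stabilizing gains has a uniform neighbourhood of stabilizing gains: the maps
  \<open>1 - w (A - B K)\<close>, with \<open>K\<close> in the set and \<open>w\<close> in the unit disc, have a uniform lower bound.\<close>

lemma uniformly_stabilizing:
  fixes A :: "real^'n^'n" and B :: "real^'m^'n"
  assumes "compact T" and stab: "\<And>K. K \<in> T \<Longrightarrow> stabilizing A B K"
  obtains \<epsilon> where "\<epsilon> > 0"
    "\<And>K K'. K \<in> T \<Longrightarrow> norm (K' - K) < \<epsilon> \<Longrightarrow> stabilizing A B K'"
proof -
  define F :: "(real^'n^'m) \<times> complex \<Rightarrow> complex^'n \<Rightarrow> complex^'n" where
    "F = (\<lambda>t v. v - snd t *s (of_real_mat (A - B ** fst t) *v v))"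
  have "continuous_on ((T \<times> cball 0 1) \<times> UNIV) (\<lambda>(t, v). F t v)"
    unfolding F_def case_prod_unfold vector_scalar_mult_def matrix_vector_mult_def vec_lambda_beta
    by (intro continuous_intros)
  moreover have "linear (F t)" for t
    unfolding F_def
    by (rule linearI) (simp_all add: vec_eq_iff matrix_vector_mult_def algebra_simps
        sum.distrib sum_subtractf sum_distrib_left scaleR_sum_right)
  moreover have "v = 0" if "t \<in> T \<times> cball 0 1" "F t v = 0" for t v
    using that stab[of "fst t"] unfolding stabilizing_def stable_mat_iff_resolvent F_def
    by (auto simp: mem_Times_iff)
  ultimately obtain m where m: "m > 0"
    "\<And>t v. t \<in> T \<times> cball 0 1 \<Longrightarrow> norm v \<le> m * norm (F t v)"
    using uniform_lower_bound[of "T \<times> cball 0 1" F] assms(1) compact_Times compact_cball by blast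
  \<comment> \<open>Replacing \<open>K\<close> by \<open>K'\<close> changes the map by at most \<open>norm B * \<epsilon>\<close>, and \<open>m * norm B * \<epsilon> \<le> 1/2\<close>.\<close>
  define \<epsilon> where "\<epsilon> = 1 / (2 * m * (norm B + 1))"
  have "\<epsilon> > 0" using m(1) by (auto simp: \<epsilon>_def intro!: divide_pos_pos mult_pos_pos add_nonneg_pos)
  moreover have "stabilizing A B K'" if K: "K \<in> T" and K': "norm (K' - K) < \<epsilon>" for K K'
    unfolding stabilizing_def stable_mat_iff_resolvent
  proof (intro allI impI)
    fix w v assume w: "cmod w \<le> 1" and v: "v - w *s (of_real_mat (A - B ** K') *v v) = 0"
    have "F (K, w) v = F (K, w) v - F (K', w) v" using v by (simp add: F_def)
    also have "\<dots> = w *s (of_real_mat (B ** (K - K')) *v v)"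
      by (simp add: F_def vec_eq_iff matrix_diff_ldistrib matrix_vector_mult_def
          sum_distrib_left algebra_simps flip: sum_subtractf)
    finally have "norm (F (K, w) v) = cmod w * norm (of_real_mat (B ** (K - K')) *v v)"
      by (simp add: norm_vec_def norm_mult L2_set_right_distrib)
    also have "\<dots> \<le> 1 * norm (of_real_mat (B ** (K - K')) *v v)"
      using w by (intro mult_right_mono) auto
    also have "\<dots> \<le> norm (of_real_mat (B ** (K - K'))) * norm v"
      using norm_matrix_vector_mult_le by simp
    also have "norm (of_real_mat (B ** (K - K'))) = norm (B ** (K - K'))"
      by (simp add: norm_vec_def)
    also have "norm (B ** (K - K')) * norm v \<le> (norm B * norm (K' - K)) * norm v"
      using norm_matrix_mult_le[of B "K - K'"] by (intro mult_right_mono) (simp_all add: norm_minus_commute)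
    also have "\<dots> \<le> ((norm B + 1) * \<epsilon>) * norm v"
      using K' by (intro mult_right_mono mult_mono) auto
    also have "(norm B + 1) * \<epsilon> = 1 / (2 * m)"
      using m(1) by (simp add: \<epsilon>_def divide_simps) (smt (verit) norm_ge_zero)
    finally have "m * norm (F (K, w) v) \<le> norm v / 2"
      using m(1) by (simp add: field_simps)
    moreover have "norm v \<le> m * norm (F (K, w) v)"
      using m(2)[of "(K, w)" v] K w by simp
    ultimately have "norm v \<le> 0" by linarith
    then show "v = 0" by simp
  qed
  ultimately show thesis by (rule that)
qed

text \<open>Subtracting the Lyapunov equations of two gains \<open>K\<close> and \<open>K'\<close> shows that \<open>P' - P\<close> solves a Lyapunov equation
  for \<open>A - B K\<close> whose right-hand side is of the order of the norm of \<open>K' - K\<close>, but still contains \<open>P'\<close>;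
  that term is absorbed by the perturbation bound for solutions of linear equations.\<close>

lemma lipschitz_policy_value:
  fixes A :: "real^'n^'n" and B :: "real^'m^'n"
  assumes "compact T" and stab: "\<And>K. K \<in> T \<Longrightarrow> stabilizing A B K"
    and S: "sym_mat S" and R: "sym_mat R"
  obtains \<epsilon> c where "\<epsilon> > 0" "c \<ge> 0"
    "\<And>K K'. K \<in> T \<Longrightarrow> norm (K' - K) < \<epsilon> \<Longrightarrow> stabilizing A B K'"
    "\<And>K K'. K \<in> T \<Longrightarrow> norm (K' - K) < \<epsilon> \<Longrightarrow>
       norm (policy_value A B S R K' - policy_value A B S R K) \<le> c * norm (K' - K)"
proof -
  obtain \<epsilon>1 where \<epsilon>1: "\<epsilon>1 > 0"
    "\<And>K K'. K \<in> T \<Longrightarrow> norm (K' - K) < \<epsilon>1 \<Longrightarrow> stabilizing A B K'"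
    using uniformly_stabilizing[OF assms(1,2)] by blast
  have "continuous_on (T \<times> UNIV) (\<lambda>(K, Y). lyap_op (A - B ** K) Y)"
    unfolding lyap_op_def case_prod_unfold by (intro continuous_intros)
  then obtain m where m: "m > 0"
    "\<And>K Y. K \<in> T \<Longrightarrow> norm Y \<le> m * norm (lyap_op (A - B ** K) Y)"
    using uniform_lower_bound[of T "\<lambda>K. lyap_op (A - B ** K)"] assms(1) linear_lyap_op
      lyap_op_injective stab unfolding stabilizing_def by blast
  have "bounded T" using assms(1) by (rule compact_imp_bounded)
  then obtain k where k: "k > 0" "\<And>K. K \<in> T \<Longrightarrow> norm K \<le> k"
    unfolding bounded_pos by blast
  define b where "b = norm B"
  define x where "x = norm A + b * k"
  have b0: "b \<ge> 0" by (simp add: b_def)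
  have x0: "x \<ge> 0" using k(1) by (simp add: x_def b_def)
  define a where "a = (2 * x + b) * b"
  have a0: "a \<ge> 0" unfolding a_def using x0 b0 by simp
  define p where "p = m * (norm S + k\<^sup>2 * norm R)"
  \<comment> \<open>With \<open>d = norm (K' - K)\<close>, the Lyapunov operators differ by at most \<open>a d\<close>. The three entries secure
    stability of \<open>A - B ** K'\<close>, the bound \<open>k + 1\<close> on \<open>K'\<close>, and the absorption condition \<open>m a d \<le> 1/2\<close>.\<close>
  define \<epsilon> where "\<epsilon> = Min {\<epsilon>1, 1, 1 / (2 * m * (a + 1))}"
  have eps: "\<epsilon> > 0" using \<epsilon>1(1) m(1) a0 by (simp add: \<epsilon>_def)
  define c where "c = 2 * m * (a * p + (2 * k + 1) * norm R)"
  have p0: "p \<ge> 0" unfolding p_def using m(1) by simp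
  have c0: "c \<ge> 0" unfolding c_def using m(1) a0 p0 k(1) by simp
  have est: "norm (policy_value A B S R K' - policy_value A B S R K) \<le> c * norm (K' - K)"
    if K: "K \<in> T" and K': "norm (K' - K) < \<epsilon>" for K K'
  proof -
    define d where "d = norm (K' - K)"
    have d: "0 \<le> d" "d < \<epsilon>1" "d \<le> 1" "d \<le> 1 / (2 * m * (a + 1))"
      using K' by (auto simp: d_def \<epsilon>_def)
    let ?X = "A - B ** K" and ?X' = "A - B ** K'"
    let ?P = "policy_value A B S R K" and ?P' = "policy_value A B S R K'"
    have st: "stabilizing A B K" "stabilizing A B K'"
      using stab[OF K] \<epsilon>1(2)[OF K] d(2) by (simp_all add: d_def)
    have K'n: "norm K' \<le> k + 1"
      using k(2)[OF K] d(3) norm_triangle_sub[of K' K] by (simp add: d_def)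
    have X: "norm ?X \<le> x"
      using norm_triangle_ineq4[of A "B ** K"] norm_matrix_mult_le[of B K]
        mult_left_mono[OF k(2)[OF K] b0] by (simp add: x_def b_def)
    have XX: "norm (?X' - ?X) \<le> b * d"
    proof -
      have "?X' - ?X = - (B ** (K' - K))" by (simp add: matrix_diff_ldistrib)
      then show ?thesis
        using norm_matrix_mult_le[of B "K' - K"] by (simp add: b_def d_def)
    qed
    have X': "norm ?X' \<le> x + b"
      using norm_triangle_sub[of ?X' ?X] X XX mult_left_mono[OF d(3) b0] by simp
    have "lyap_op ?X (?P' - ?P) = (lyap_op ?X ?P' - lyap_op ?X' ?P') + (lyap_op ?X' ?P' - lyap_op ?X ?P)"
      by (simp add: linear_diff[OF linear_lyap_op])
    also have "lyap_op ?X ?P' - lyap_op ?X' ?P'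
      = - (transpose ?X' ** ?P' ** ?X' - transpose ?X ** ?P' ** ?X)"
      by (simp add: lyap_op_def)
    also have "lyap_op ?X' ?P' - lyap_op ?X ?P = - (transpose K' ** R ** K' - transpose K ** R ** K)"
      using st S R by (simp add: policy_value_properties(2))
    finally have "norm (lyap_op ?X (?P' - ?P))
      \<le> norm (transpose ?X' ** ?P' ** ?X' - transpose ?X ** ?P' ** ?X)
        + norm (transpose K' ** R ** K' - transpose K ** R ** K)"
      using norm_triangle_ineq by (metis norm_minus_cancel)
    also have "\<dots> \<le> (norm ?X + norm ?X') * norm (?X' - ?X) * norm ?P'
        + (norm K + norm K') * norm (K' - K) * norm R"
      by (intro add_mono norm_congruence_diff_le)
    also have "\<dots> \<le> (2 * x + b) * (b * d) * norm ?P' + (2 * k + 1) * d * norm R"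
    proof -
      have "norm ?X + norm ?X' \<le> 2 * x + b" "norm K + norm K' \<le> 2 * k + 1"
        using X X' K'n k(2)[OF K] by auto
      then show ?thesis
        using XX x0 b0 k(1) d(1) unfolding d_def
        by - (rule add_mono; intro mult_mono mult_nonneg_nonneg; simp)
    qed
    finally have L: "norm (lyap_op ?X (?P' - ?P)) \<le> a * d * norm ?P' + (2 * k + 1) * d * norm R"
      by (simp add: a_def mult.assoc)
    have "norm (?P' - ?P) \<le> m * (a * d * norm ?P' + (2 * k + 1) * d * norm R)"
      using m(2)[OF K, of "?P' - ?P"] mult_left_mono[OF L, of m] m(1) by linarith
    moreover have "m * (a * d) \<le> 1/2"
    proof -
      have "m * (a * d) \<le> m * ((a + 1) * (1 / (2 * m * (a + 1))))"
        using m(1) a0 d by (intro mult_left_mono mult_mono) auto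
      also have "\<dots> = 1/2"
      proof -
        have "a + 1 \<noteq> 0" using a0 by simp
        then show ?thesis using m(1) by simp
      qed
      finally show ?thesis .
    qed
    ultimately have "norm (?P' - ?P) \<le> 2 * m * (a * d * norm ?P + (2 * k + 1) * d * norm R)"
      using m(1) a0 d(1) by (intro perturbed_solution_bound) auto
    also have "\<dots> \<le> 2 * m * (a * d * p + (2 * k + 1) * d * norm R)"
    proof -
      have "norm ?P \<le> m * norm (- S - transpose K ** R ** K)"
        using m(2)[OF K, of ?P] st S R by (simp add: policy_value_properties(2))
      also have "norm (- S - transpose K ** R ** K) \<le> norm S + k\<^sup>2 * norm R"
      proof -
        have "(norm K)\<^sup>2 * norm R \<le> k\<^sup>2 * norm R"
          using k(2)[OF K] by (intro mult_right_mono power_mono) auto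
        then show ?thesis
          using norm_triangle_ineq4[of "- S" "transpose K ** R ** K"] norm_congruence_le[of K R]
          by simp
      qed
      finally have "norm ?P \<le> p" using m(1) by (simp add: p_def)
      then show ?thesis
        using m(1) a0 d(1) by (intro mult_left_mono add_right_mono) auto
    qed
    also have "\<dots> = c * d" by (simp add: c_def algebra_simps)
    finally show ?thesis by (simp add: d_def)
  qed
  have "stabilizing A B K'" if "K \<in> T" "norm (K' - K) < \<epsilon>" for K K'
    using \<epsilon>1(2)[of K K'] that by (simp add: \<epsilon>_def)
  then show thesis using that[OF eps c0] est by blast
qed

section \<open>The gain update under a perturbation of its data\<close>

lemma norm_reindex_le:
  fixes x :: "'a::real_normed_vector^'n" and f :: "'m::finite \<Rightarrow> 'n"
  assumes "inj f"
  shows "norm (\<chi> j. x $ f j) \<le> norm x"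
proof -
  have "(\<Sum>j\<in>UNIV. (norm (x $ f j))\<^sup>2) = (\<Sum>k\<in>range f. (norm (x $ k))\<^sup>2)"
    using assms by (simp add: sum.reindex)
  also have "\<dots> \<le> (\<Sum>k\<in>UNIV. (norm (x $ k))\<^sup>2)"
    by (intro sum_mono2) auto
  finally show ?thesis by (simp add: norm_vec_def L2_set_def)
qed

lemma norm_block_uu_le: "norm (block_uu E) \<le> norm E"
proof -
  have "norm (block_uu E) \<le> norm (\<chi> i. E $ Inr i)"
    by (rule norm_le_componentwise_cart) (simp add: block_uu_def norm_reindex_le)
  then show ?thesis
    using norm_reindex_le[of Inr E] by simp
qed

lemma norm_block_ux_le: "norm (block_ux E) \<le> norm E"
proof -
  have "norm (block_ux E) \<le> norm (\<chi> i. E $ Inr i)"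
    by (rule norm_le_componentwise_cart) (simp add: block_ux_def norm_reindex_le)
  then show ?thesis
    using norm_reindex_le[of Inr E] by simp
qed

lemma block_uu_G_op_add: "block_uu (G_op A B S R P + E) = R_op B R P + block_uu E"
  by (simp add: block_uu_def G_op_def block_matrix_def R_op_def vec_eq_iff)

lemma block_ux_G_op_add: "block_ux (G_op A B S R P + E) = transpose B ** P ** A + block_ux E"
  by (simp add: block_ux_def G_op_def block_matrix_def vec_eq_iff)

text \<open>The gain solves the linear equation \<open>R_op B R P ** K = B\<^sup>T P A\<close>, so the perturbation bound applies again. The set
  of unperturbed gains is compact because the pairs
  \<open>(P, K)\<close> that satisfy the equation, with \<open>K\<close> bounded, form a compact set, and the
  gains are its projection.\<close>

lemma lipschitz_policy_gain:
  fixes A :: "real^'n^'n" and B :: "real^'m^'n"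
  assumes C: "compact C" and inv: "\<And>P. P \<in> C \<Longrightarrow> invertible (R_op B R P)"
  obtains \<delta> c where "\<delta> > 0" "c \<ge> 0" "compact (K_op A B R ` C)"
    "\<And>P E. P \<in> C \<Longrightarrow> norm E < \<delta> \<Longrightarrow> invertible (block_uu (G_op A B S R P + E))"
    "\<And>P E. P \<in> C \<Longrightarrow> norm E < \<delta> \<Longrightarrow>
       norm (policy_gain (G_op A B S R P + E) - K_op A B R P) \<le> c * norm E"
proof -
  define N where "N P = transpose B ** P ** A" for P
  let ?K = "K_op A B R"
  have K: "R_op B R P ** ?K P = N P" if "P \<in> C" for P
    using inv[OF that] by (simp add: K_op_def N_def matrix_inv_right flip: matrix_mul_assoc)
  have cont: "continuous_on (C \<times> UNIV) (\<lambda>(P, Y :: real^'n^'m). R_op B R P ** Y)"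
    unfolding R_op_def case_prod_unfold by (intro continuous_intros)
  moreover have "linear (\<lambda>Y :: real^'n^'m. R_op B R P ** Y)" for P
    using bounded_bilinear.bounded_linear_right[OF bounded_bilinear_matrix_mult]
    by (rule bounded_linear.linear)
  moreover have "Y = 0" if "P \<in> C" "R_op B R P ** Y = 0" for P and Y :: "real^'n^'m"
    using inv[OF that(1)] that(2)
    by (metis invertible_left_inverse matrix_mul_assoc matrix_mul_lid times0_right)
  ultimately obtain m where m: "m > 0"
    "\<And>P (Y :: real^'n^'m). P \<in> C \<Longrightarrow> norm Y \<le> m * norm (R_op B R P ** Y)"
    using uniform_lower_bound[of C "\<lambda>P Y. R_op B R P ** Y"] C by blast
  have "bounded (N ` C)"
    unfolding N_def by (intro compact_imp_bounded compact_continuous_image C continuous_intros)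
  then obtain r where r: "r > 0" "\<And>P. P \<in> C \<Longrightarrow> norm (N P) \<le> r"
    unfolding bounded_pos by blast
  define \<kappa> where "\<kappa> = m * r"
  have \<kappa>: "norm (?K P) \<le> \<kappa>" if "P \<in> C" for P
  proof -
    have "norm (?K P) \<le> m * norm (N P)"
      using m(2)[OF that, of "?K P"] K[OF that] by simp
    also have "\<dots> \<le> \<kappa>"
      using r(2)[OF that] m(1) by (simp add: \<kappa>_def)
    finally show ?thesis .
  qed
  have cpt: "compact (?K ` C)"
  proof -
    let ?T = "{t \<in> C \<times> cball 0 \<kappa>. R_op B R (fst t) ** snd t - N (fst t) = 0}"
    have "closed ?T"
      unfolding R_op_def N_def
      by (intro continuous_closed_preimage_constant continuous_intros closed_Times
          compact_imp_closed C closed_cball)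
    then have "compact ((C \<times> cball 0 \<kappa>) \<inter> ?T)"
      by (intro compact_Int_closed compact_Times C compact_cball)
    moreover have "?K ` C = snd ` ((C \<times> cball 0 \<kappa>) \<inter> ?T)"
    proof (intro set_eqI iffI)
      fix k assume "k \<in> ?K ` C"
      then obtain P where "P \<in> C" "k = ?K P" by blast
      then show "k \<in> snd ` ((C \<times> cball 0 \<kappa>) \<inter> ?T)"
        using K \<kappa> by (intro image_eqI[of _ _ "(P, k)"]) auto
    next
      fix k assume "k \<in> snd ` ((C \<times> cball 0 \<kappa>) \<inter> ?T)"
      then obtain P where P: "P \<in> C" "R_op B R P ** k = N P" by auto
      then have "R_op B R P ** (k - ?K P) = 0"
        using K by (simp add: matrix_diff_ldistrib)
      then have "k = ?K P" using m(2)[OF P(1), of "k - ?K P"] by simp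
      with P(1) show "k \<in> ?K ` C" by blast
    qed
    ultimately show ?thesis
      by (simp add: compact_continuous_image continuous_on_snd)
  qed
  define \<delta> where "\<delta> = 1 / (2 * m)"
  have \<delta>: "m * norm E \<le> 1/2" if "norm E < \<delta>" for E :: "real^('n + 'm)^('n + 'm)"
    using that m(1) by (simp add: \<delta>_def field_simps)
  have inv': "invertible (block_uu (G_op A B S R P + E))"
    if P: "P \<in> C" and E: "norm E < \<delta>" for P and E :: "real^('n + 'm)^('n + 'm)"
    unfolding invertible_left_inverse matrix_left_invertible_ker
  proof (intro allI impI)
    fix y assume "block_uu (G_op A B S R P + E) *v y = 0"
    then have y: "R_op B R P *v y = - (block_uu E *v y)"
      unfolding block_uu_G_op_add matrix_vector_mult_add_rdistrib by (simp add: eq_neg_iff_add_eq_0)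
    \<comment> \<open>The lower bound is about matrices; repeat the vector \<open>y\<close> in all columns.\<close>
    define Y :: "real^'n^'m" where "Y = (\<chi> i j. y $ i)"
    have mult_Y: "(M ** Y) $ i $ j = (M *v y) $ i" for M :: "real^'m^'m" and i j
      by (simp add: Y_def matrix_matrix_mult_def matrix_vector_mult_def)
    have "R_op B R P ** Y = - (block_uu E ** Y)"
      using y by (simp add: vec_eq_iff mult_Y)
    then have "norm (R_op B R P ** Y) \<le> norm E * norm Y"
      using order_trans[OF norm_matrix_mult_le mult_right_mono[OF norm_block_uu_le]] by fastforce
    then have "m * norm (R_op B R P ** Y) \<le> m * (norm E * norm Y)"
      using m(1) by simp
    also have "\<dots> \<le> 1/2 * norm Y"
      using mult_right_mono[OF \<delta>[OF E], of "norm Y"] by (simp add: mult.assoc)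
    finally have "norm Y \<le> 0" using m(2)[OF P, of Y] by linarith
    then have "Y = 0" by simp
    then show "y = 0" by (simp add: Y_def vec_eq_iff)
  qed
  have "norm (policy_gain (G_op A B S R P + E) - ?K P) \<le> 2 * m * (\<kappa> + 1) * norm E"
    if P: "P \<in> C" and E: "norm E < \<delta>" for P and E :: "real^('n + 'm)^('n + 'm)"
  proof -
    define k where "k = policy_gain (G_op A B S R P + E)"
    have "(R_op B R P + block_uu E) ** k = N P + block_ux E"
      using inv'[OF P E] unfolding k_def policy_gain_def
      by (simp add: matrix_inv_right block_uu_G_op_add block_ux_G_op_add N_def)
    then have "R_op B R P ** (k - ?K P) = block_ux E - block_uu E ** k"
      using K[OF P] by (simp add: matrix_diff_ldistrib matrix_add_rdistrib algebra_simps)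
    also have "norm \<dots> \<le> norm (block_ux E) + norm (block_uu E ** k)"
      by (rule norm_triangle_ineq4)
    also have "\<dots> \<le> norm E + norm E * norm k"
      by (intro add_mono norm_block_ux_le order_trans[OF norm_matrix_mult_le]
          mult_right_mono norm_block_uu_le) simp
    finally have "norm (k - ?K P) \<le> m * (norm E * norm k + norm E)"
      using m(2)[OF P, of "k - ?K P"] m(1) by (smt (verit) mult_left_mono)
    then have "norm (k - ?K P) \<le> 2 * m * (norm E * norm (?K P) + norm E)"
      by (rule perturbed_solution_bound) (use \<delta>[OF E] m(1) in auto)
    also have "\<dots> \<le> 2 * m * (norm E * \<kappa> + norm E)"
      using m(1) \<kappa>[OF P] by (intro mult_left_mono add_right_mono) auto
    finally show ?thesis by (simp add: k_def algebra_simps)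
  qed
  moreover have "\<delta> > 0" "2 * m * (\<kappa> + 1) \<ge> 0"
    using m(1) r(1) by (simp_all add: \<delta>_def \<kappa>_def)
  ultimately show thesis using that cpt inv' by blast
qed

section \<open>Inexact policy iteration\<close>

text \<open>The transition map is the composition of the gain update and the policy evaluation. Both are
  Lipschitz near compact sets, hence the effect of the disturbance is linear in its size, uniformly over \<open>C\<close>.\<close>

lemma lipschitz_pi_step:
  fixes A :: "real^'n^'n" and B :: "real^'m^'n"
  assumes C: "compact C" and S: "sym_mat S" and R: "sym_mat R"
    and inv: "\<And>P. P \<in> C \<Longrightarrow> invertible (R_op B R P)"
    and stab: "\<And>P. P \<in> C \<Longrightarrow> stabilizing A B (K_op A B R P)"
  obtains \<delta> c \<kappa> where "\<delta> > 0" "c > 0"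
    "\<And>P E. P \<in> C \<Longrightarrow> norm E < \<delta> \<Longrightarrow>
       invertible (block_uu (G_op A B S R P + E)) \<and>
       stabilizing A B (policy_gain (G_op A B S R P + E)) \<and>
       norm (policy_gain (G_op A B S R P + E)) \<le> \<kappa> \<and>
       norm (pi_step A B S R P E - pi_step A B S R P 0) \<le> c * norm E"
proof -
  obtain \<delta> c where g: "\<delta> > 0" "c \<ge> 0" "compact (K_op A B R ` C)"
    "\<And>P E. P \<in> C \<Longrightarrow> norm E < \<delta> \<Longrightarrow> invertible (block_uu (G_op A B S R P + E))"
    "\<And>P E. P \<in> C \<Longrightarrow> norm E < \<delta> \<Longrightarrow>
       norm (policy_gain (G_op A B S R P + E) - K_op A B R P) \<le> c * norm E"
    using lipschitz_policy_gain[OF C inv, where A = A and S = S] by blast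
  obtain \<epsilon> c' where v: "\<epsilon> > 0" "c' \<ge> 0"
    "\<And>K K'. K \<in> K_op A B R ` C \<Longrightarrow> norm (K' - K) < \<epsilon> \<Longrightarrow> stabilizing A B K'"
    "\<And>K K'. K \<in> K_op A B R ` C \<Longrightarrow> norm (K' - K) < \<epsilon> \<Longrightarrow>
       norm (policy_value A B S R K' - policy_value A B S R K) \<le> c' * norm (K' - K)"
    using lipschitz_policy_value[OF g(3) _ S R, where A = A and B = B] stab by blast
  obtain k where k: "\<And>P. P \<in> C \<Longrightarrow> norm (K_op A B R P) \<le> k"
    using compact_imp_bounded[OF g(3)] unfolding bounded_iff by blast
  define \<delta>' where "\<delta>' = min \<delta> (\<epsilon> / (c + 1))"
  have "\<delta>' > 0" using g(1,2) v(1) by (simp add: \<delta>'_def)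
  moreover have "c' * c + 1 > 0" using g(2) v(2) by (simp add: add_nonneg_pos)
  moreover have "invertible (block_uu (G_op A B S R P + E)) \<and>
       stabilizing A B (policy_gain (G_op A B S R P + E)) \<and>
       norm (policy_gain (G_op A B S R P + E)) \<le> k + \<epsilon> \<and>
       norm (pi_step A B S R P E - pi_step A B S R P 0) \<le> (c' * c + 1) * norm E"
    if P: "P \<in> C" and "norm E < \<delta>'" for P and E :: "real^('n + 'm)^('n + 'm)"
  proof -
    have E: "norm E < \<delta>" "norm E < \<epsilon> / (c + 1)"
      using that(2) by (simp_all add: \<delta>'_def)
    let ?g = "policy_gain (G_op A B S R P + E)"
    have d: "norm (?g - K_op A B R P) \<le> c * norm E"
      using g(5)[OF P E(1)] .
    also have "\<dots> \<le> (c + 1) * norm E"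
      by (intro mult_right_mono) auto
    also have "\<dots> < \<epsilon>"
      using E(2) g(2) by (simp add: field_simps)
    finally have d': "norm (?g - K_op A B R P) < \<epsilon>" .
    have "norm ?g \<le> k + \<epsilon>"
      using d' k[OF P] norm_triangle_sub[of ?g "K_op A B R P"] by linarith
    moreover have "pi_step A B S R P 0 = policy_value A B S R (K_op A B R P)"
      by (simp add: pi_step_def policy_gain_G_op)
    then have "norm (pi_step A B S R P E - pi_step A B S R P 0) \<le> c' * norm (?g - K_op A B R P)"
      using v(4)[of "K_op A B R P" ?g] d' P by (simp add: pi_step_def)
    then have "norm (pi_step A B S R P E - pi_step A B S R P 0) \<le> (c' * c + 1) * norm E"
      using mult_left_mono[OF d v(2)] by (simp add: distrib_right add_increasing2 mult.assoc)
    ultimately show ?thesis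
      using g(4)[OF P E(1)] v(3)[of "K_op A B R P" ?g] d' P by blast
  qed
  ultimately show thesis by (rule that)
qed

text \<open>The disturbances are summed against a geometric series.\<close>

lemma perturbed_contraction_bound:
  fixes x d :: "nat \<Rightarrow> real"
  assumes "0 \<le> \<sigma>" "\<sigma> < 1" "0 \<le> c"
    and step: "\<And>i. x (Suc i) \<le> \<sigma> * x i + c * d i"
    and d: "\<And>i. 0 \<le> d i" "\<And>i. d i \<le> D"
  shows "x i \<le> \<sigma> ^ i * x 0 + c * D / (1 - \<sigma>)"
proof (induction i)
  case 0
  have "0 \<le> D" using d(1)[of 0] d(2)[of 0] by linarith
  then show ?case using assms(2,3) by simp
next
  case (Suc i)
  have "x (Suc i) \<le> \<sigma> * (\<sigma> ^ i * x 0 + c * D / (1 - \<sigma>)) + c * D"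
    using step[of i] mult_left_mono[OF Suc assms(1)] mult_left_mono[OF d(2)[of i] assms(3)]
    by linarith
  also have "\<dots> = \<sigma> ^ Suc i * x 0 + c * D / (1 - \<sigma>)"
    using assms(2) by (simp add: field_simps)
  finally show ?case .
qed

text \<open>The bound for bounded disturbances, applied from a time after which all disturbances are small.\<close>

lemma perturbed_contraction_tendsto_0:
  fixes x d :: "nat \<Rightarrow> real"
  assumes \<sigma>: "0 \<le> \<sigma>" "\<sigma> < 1" "0 \<le> c"
    and step: "\<And>i. x (Suc i) \<le> \<sigma> * x i + c * d i"
    and nonneg: "\<And>i. 0 \<le> x i" "\<And>i. 0 \<le> d i" and d: "d \<longlonglongrightarrow> 0"
  shows "x \<longlonglongrightarrow> 0"
proof (rule LIMSEQ_I)
  fix e :: real assume e: "0 < e"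
  \<comment> \<open>This threshold makes \<open>c \<eta> / (1 - \<sigma>)\<close> at most \<open>e / 2\<close>.\<close>
  define \<eta> where "\<eta> = (1 - \<sigma>) * e / (2 * (c + 1))"
  have "\<eta> > 0" using \<sigma> e by (simp add: \<eta>_def)
  then obtain N where N: "\<And>i. i \<ge> N \<Longrightarrow> d i < \<eta>"
    using LIMSEQ_D[OF d, of \<eta>] nonneg(2) by auto
  have "1 - \<sigma> \<noteq> 0" "c + 1 \<noteq> 0" using \<sigma> by auto
  then have "c * \<eta> / (1 - \<sigma>) = c / (c + 1) * (e / 2)"
    by (simp add: \<eta>_def)
  also have "\<dots> \<le> 1 * (e / 2)"
    using \<sigma> e by (intro mult_right_mono) auto
  finally have \<eta>: "c * \<eta> / (1 - \<sigma>) \<le> e / 2" by simp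
  have bound: "x (i + N) \<le> \<sigma> ^ i * x N + e / 2" for i
  proof -
    have "d (j + N) \<le> \<eta>" for j using N[of "j + N"] by simp
    then have "x (i + N) \<le> \<sigma> ^ i * x (0 + N) + c * \<eta> / (1 - \<sigma>)"
      using \<sigma> step nonneg(2)
      by (intro perturbed_contraction_bound[where d = "\<lambda>i. d (i + N)"]) simp_all
    with \<eta> show ?thesis by (metis add_0 add_left_mono order_trans)
  qed
  have "(\<lambda>i. \<sigma> ^ i * x N) \<longlonglongrightarrow> 0"
    using \<sigma> by (intro tendsto_mult_left_zero LIMSEQ_power_zero) simp
  then obtain M where M: "\<And>i. i \<ge> M \<Longrightarrow> \<sigma> ^ i * x N < e / 2"
    using order_tendstoD(2)[of _ 0 sequentially "e / 2"] e
    unfolding eventually_sequentially by auto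
  have "norm (x i - 0) < e" if "i \<ge> M + N" for i
  proof -
    have "M \<le> i - N" "i - N + N = i" using that by auto
    with bound[of "i - N"] M[of "i - N"] nonneg(1)[of i] show ?thesis by simp
  qed
  then show "\<exists>n0. \<forall>n\<ge>n0. norm (x n - 0) < e" by blast
qed

lemma class_K_linear: "0 < a \<Longrightarrow> class_K (\<lambda>y. a * y)"
  unfolding class_K_def
  by (auto intro!: continuous_intros strict_mono_onI)

lemma class_KL_geometric:
  assumes "0 < \<sigma>" "\<sigma> < 1"
  shows "class_KL (\<lambda>y t. \<sigma> powr t * y)"
  unfolding class_KL_def
proof (intro conjI allI impI)
  show "class_K (\<lambda>y. \<sigma> powr t * y)" for t
    using assms(1) by (simp add: class_K_linear)
  fix y :: real assume y: "0 \<le> y"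
  show "antimono_on {0..} (\<lambda>t. \<sigma> powr t * y)"
    using assms y by (intro monotone_onI mult_right_mono powr_mono') auto
  have "((\<lambda>t. \<sigma> powr t) \<longlongrightarrow> 0) at_top"
    unfolding powr_def mult.commute[of _ "ln \<sigma>"] using assms
    by (simp, intro filterlim_compose[OF exp_at_bot]
        filterlim_tendsto_neg_mult_at_bot[OF tendsto_const _ filterlim_ident]) simp
  then show "((\<lambda>t. \<sigma> powr t * y) \<longlongrightarrow> 0) at_top"
    by (rule tendsto_mult_left_zero)
qed

lemma norm_le_sup_norm: "bounded (range u) \<Longrightarrow> norm (u i) \<le> sup_norm u"
  unfolding sup_norm_def
  by (rule cSUP_upper) (auto simp: bounded_iff bdd_above_def)

theorem lemma2:
  fixes A :: "real^'n^'n" and B :: "real^'m^'n"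
    and S :: "real^'n^'n" and R :: "real^'m^'m"
    and Pstar :: "real^'n^'n" and \<sigma> \<delta>0 :: real
  assumes "controllable A B"
    and "psd S" and "observable A (psd_sqrt S)"
    and "pd R"
    and "pd Pstar" and "riccati A B S R Pstar = 0"
    and "\<And>P. pd P \<Longrightarrow> riccati A B S R P = 0 \<Longrightarrow> P = Pstar"
    and "0 < \<sigma>" and "\<sigma> < 1" and "0 < \<delta>0"
    and "\<And>P. sym_mat P \<Longrightarrow> norm (P - Pstar) < \<delta>0 \<Longrightarrow>
           invertible (R_op B R P) \<and>
           stable_mat (closed_loop A B (K_op A B R P)) \<and>
           norm (inv (lyap_op (closed_loop A B (K_op A B R P)))
                   (- S - transpose (K_op A B R P) ** R ** K_op A B R P) - Pstar)
             \<le> \<sigma> * norm (P - Pstar)"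
  shows "\<exists>\<delta>1>0. \<exists>c3>0.
      locally_ISS_with (pi_step A B S R) {P. sym_mat P} {E. sym_mat E} Pstar
        (\<lambda>y t. \<sigma> powr t * y) (\<lambda>y. c3 * y / (1 - \<sigma>)) \<and>
      (\<forall>P0 \<Delta>G.
         sym_mat P0 \<and> \<Delta>G 0 = 0 \<and> (\<forall>i. sym_mat (\<Delta>G i)) \<and>
         bounded (range \<Delta>G) \<and> sup_norm \<Delta>G < \<delta>1 \<and> norm (P0 - Pstar) < \<delta>0 \<longrightarrow>
           (\<forall>i>0. invertible (block_uu (G_hat A B S R P0 \<Delta>G i)) \<and>
                  stabilizing A B (K_hat A B S R P0 \<Delta>G i)) \<and>
           (\<forall>i. norm (P_tilde A B S R P0 \<Delta>G i - Pstar)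
                  \<le> \<sigma> ^ i * norm (P0 - Pstar) + c3 * sup_norm \<Delta>G / (1 - \<sigma>)) \<and>
           (\<exists>\<kappa>1\<ge>0. \<forall>i>0. norm (K_hat A B S R P0 \<Delta>G i) < \<kappa>1) \<and>
           ((\<lambda>i. norm (\<Delta>G i)) \<longlonglongrightarrow> 0 \<longrightarrow>
              (\<lambda>i. norm (P_tilde A B S R P0 \<Delta>G i - Pstar)) \<longlonglongrightarrow> 0))"
proof -
  let ?f = "pi_step A B S R"
  have S: "sym_mat S" and R: "sym_mat R" and Pstar: "sym_mat Pstar"
    using assms(2,4,5) by (auto simp: psd_def pd_def)
  note \<sigma> = assms(8,9) and \<delta>0 = assms(10)
  have local_inv: "invertible (R_op B R P)"
    and local_stab: "stabilizing A B (K_op A B R P)"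
    and local_contr: "norm (?f P 0 - Pstar) \<le> \<sigma> * norm (P - Pstar)"
    if "sym_mat P" "norm (P - Pstar) < \<delta>0" for P
  proof -
    show inv: "invertible (R_op B R P)" and st: "stabilizing A B (K_op A B R P)"
      using assms(11)[OF that] by (simp_all add: stabilizing_def closed_loop_def)
    show "norm (?f P 0 - Pstar) \<le> \<sigma> * norm (P - Pstar)"
      using assms(11)[OF that] policy_value_properties(1)[OF st S R]
      by (simp add: pi_step_def policy_gain_G_op closed_loop_def)
  qed
  \<comment> \<open>The ball of radius \<open>\<delta>0\<close> is open, and constants need not be uniform on it. But the first step
    is undisturbed, so it leads into the closed ball of radius \<open>\<sigma> \<delta>0\<close>, where compactness is available.\<close>
  define \<rho> where "\<rho> = \<sigma> * \<delta>0"
  have \<rho>: "0 < \<rho>" "\<rho> < \<delta>0" using \<sigma> \<delta>0 by (simp_all add: \<rho>_def)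
  define C where "C = {P. sym_mat P} \<inter> cball Pstar \<rho>"
  have C_iff: "P \<in> C \<longleftrightarrow> sym_mat P \<and> norm (P - Pstar) \<le> \<rho>" for P
    by (auto simp: C_def dist_norm norm_minus_commute)
  have "closed {P :: real^'n^'n. sym_mat P}"
    unfolding sym_mat_def by (intro closed_Collect_eq continuous_intros)
  then have "compact C"
    unfolding C_def by (intro closed_Int_compact compact_cball)
  moreover have "invertible (R_op B R P)" "stabilizing A B (K_op A B R P)" if "P \<in> C" for P
    using that \<rho> by (auto simp: C_iff intro!: local_inv local_stab)
  ultimately obtain \<delta> c \<kappa> where \<delta>: "\<delta> > 0" and c: "c > 0" and
    step: "\<And>P E. P \<in> C \<Longrightarrow> norm E < \<delta> \<Longrightarrow>
       invertible (block_uu (G_op A B S R P + E)) \<and>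
       stabilizing A B (policy_gain (G_op A B S R P + E)) \<and>
       norm (policy_gain (G_op A B S R P + E)) \<le> \<kappa> \<and>
       norm (?f P E - ?f P 0) \<le> c * norm E"
    using lipschitz_pi_step[OF _ S R, of C B A] by blast
  \<comment> \<open>Disturbances below the second bound keep the closed ball invariant: \<open>\<sigma> \<rho> + c \<delta>1 \<le> \<rho>\<close>.\<close>
  define \<delta>1 where "\<delta>1 = min \<delta> ((1 - \<sigma>) * \<rho> / c)"
  have \<delta>1: "\<delta>1 > 0" using \<delta> c \<sigma> \<rho> by (simp add: \<delta>1_def)
  have contr: "norm (?f P E - Pstar) \<le> \<sigma> * norm (P - Pstar) + c * norm E"
    and invariant: "?f P E \<in> C" if P: "P \<in> C" and E: "norm E < \<delta>1" for P E
  proof -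
    have E': "norm E < \<delta>" "c * norm E \<le> (1 - \<sigma>) * \<rho>"
      using E c by (simp_all add: \<delta>1_def field_simps)
    have "norm (?f P 0 - Pstar) \<le> \<sigma> * norm (P - Pstar)"
      using P \<rho> by (intro local_contr) (auto simp: C_iff)
    then show b: "norm (?f P E - Pstar) \<le> \<sigma> * norm (P - Pstar) + c * norm E"
      using step[OF P E'(1)] norm_triangle_ineq[of "?f P E - ?f P 0" "?f P 0 - Pstar"] by simp
    have "\<sigma> * norm (P - Pstar) \<le> \<sigma> * \<rho>"
      using P \<sigma> by (simp add: C_iff)
    with b E'(2) have "norm (?f P E - Pstar) \<le> \<rho>" by (simp add: algebra_simps)
    moreover have "sym_mat (?f P E)"
      using step[OF P E'(1)] S R by (simp add: pi_step_def policy_value_properties(3))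
    ultimately show "?f P E \<in> C" by (simp add: C_iff)
  qed
  have iss: "locally_ISS_with ?f {P. sym_mat P} {E. sym_mat E} Pstar
        (\<lambda>y t. \<sigma> powr t * y) (\<lambda>y. c * y / (1 - \<sigma>))"
    unfolding locally_ISS_with_def
  proof (intro conjI)
    show "Pstar \<in> {P. sym_mat P}" using Pstar by simp
    show "?f Pstar 0 = Pstar" using local_contr[OF Pstar] \<delta>0 by simp
    show "class_KL (\<lambda>y t. \<sigma> powr t * y)" using \<sigma> by (rule class_KL_geometric)
    show "class_K (\<lambda>y. c * y / (1 - \<sigma>))"
      using class_K_linear[of "c / (1 - \<sigma>)"] c \<sigma> by simp
    \<comment> \<open>Here the first input may be nonzero, so the initial state has to lie in the closed ball already.\<close>
    have "norm (x k - Pstar) \<le> \<sigma> powr real k * norm (x 0 - Pstar) + c * sup_norm u / (1 - \<sigma>)"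
      if x: "x 0 \<in> {P. sym_mat P}" "\<And>k. x (Suc k) = ?f (x k) (u k)" "norm (x 0 - Pstar) < \<rho>"
        and u: "bounded (range u)" "sup_norm u < \<delta>1" for x u k
    proof -
      have u': "norm (u i) < \<delta>1" for i
        using norm_le_sup_norm[OF u(1)] u(2) by (rule le_less_trans)
      have "x i \<in> C" for i
        by (induction i) (use x u' invariant in \<open>auto simp: C_iff\<close>)
      then have "norm (x (Suc i) - Pstar) \<le> \<sigma> * norm (x i - Pstar) + c * norm (u i)" for i
        using contr u' x(2) by simp
      then have "norm (x k - Pstar) \<le> \<sigma> ^ k * norm (x 0 - Pstar) + c * sup_norm u / (1 - \<sigma>)"
        using \<sigma> c norm_le_sup_norm[OF u(1)]
        by (intro perturbed_contraction_bound[where d = "\<lambda>i. norm (u i)"]) auto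
      then show ?thesis using \<sigma> by (simp add: powr_realpow)
    qed
    then show "\<exists>\<alpha>1>0. \<exists>\<alpha>2>0. \<forall>x u.
        x 0 \<in> {P. sym_mat P} \<and> range u \<subseteq> {E. sym_mat E} \<and> (\<forall>k. x (Suc k) = ?f (x k) (u k)) \<and>
        norm (x 0 - Pstar) < \<alpha>1 \<and> bounded (range u) \<and> sup_norm u < \<alpha>2 \<longrightarrow>
        (\<forall>k. norm (x k - Pstar) \<le> \<sigma> powr real k * norm (x 0 - Pstar) + c * sup_norm u / (1 - \<sigma>))"
      using \<rho>(1) \<delta>1 by blast
  qed
  show ?thesis
  proof (rule exI[of _ \<delta>1], rule conjI[OF \<delta>1], rule exI[of _ c], rule conjI[OF c],
      rule conjI[OF iss], intro allI impI, elim conjE)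
    fix P0 :: "real^'n^'n" and \<Delta>G :: "nat \<Rightarrow> real^('n + 'm)^('n + 'm)"
    assume P0: "sym_mat P0" "norm (P0 - Pstar) < \<delta>0" and \<Delta>G0: "\<Delta>G 0 = 0"
      and \<Delta>G: "bounded (range \<Delta>G)" "sup_norm \<Delta>G < \<delta>1"
    let ?P = "P_tilde A B S R P0 \<Delta>G" and ?K = "K_hat A B S R P0 \<Delta>G"
    have small: "norm (\<Delta>G i) < \<delta>1" for i
      using norm_le_sup_norm[OF \<Delta>G(1)] \<Delta>G(2) by (rule le_less_trans)
    then have small': "norm (\<Delta>G i) < \<delta>" for i
      using small[of i] by (simp add: \<delta>1_def)
    note P_Suc = P_tilde_Suc[where D = \<Delta>G, OF \<Delta>G0, of A B S R P0]
    have P_0: "?P 0 = P0" by (simp add: P_tilde_def)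
    have K_1: "?K (Suc 0) = K_op A B R P0" by simp
    have st1: "stabilizing A B (?K (Suc 0))"
      unfolding K_1 using P0 by (intro local_stab)
    have contr0: "norm (?P (Suc 0) - Pstar) \<le> \<sigma> * norm (?P 0 - Pstar)"
      using local_contr[OF P0] by (simp add: P_Suc \<Delta>G0 P_0)
    have in_C: "?P (Suc i) \<in> C" for i
    proof (induction i)
      case 0
      have "sym_mat (?P (Suc 0))"
        using policy_value_properties(3)[OF st1 S R] by (simp add: P_tilde_def)
      moreover have "\<sigma> * norm (?P 0 - Pstar) \<le> \<rho>"
        using P0(2) \<sigma> by (simp add: P_0 \<rho>_def)
      ultimately show ?case using contr0 by (simp add: C_iff)
    next
      case (Suc i)
      then show ?case
        using invariant[OF Suc small] by (simp only: P_Suc[of "Suc i"])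
    qed
    have rec: "norm (?P (Suc i) - Pstar) \<le> \<sigma> * norm (?P i - Pstar) + c * norm (\<Delta>G i)" for i
    proof (cases i)
      case 0
      then show ?thesis using contr0 by (simp add: \<Delta>G0)
    next
      case (Suc j)
      then show ?thesis
        using contr[OF in_C[of j] small[of i]] P_Suc[of i] by (simp only: Suc)
    qed
    have K_Suc: "?K (Suc (Suc i)) = policy_gain (G_op A B S R (?P (Suc i)) + \<Delta>G (Suc i))" for i
      by (simp add: P_tilde_def)
    have G_hat_Suc: "G_hat A B S R P0 \<Delta>G (Suc i) = G_op A B S R (?P (Suc i)) + \<Delta>G (Suc i)" for i
      by (simp add: G_hat_def)
    note step' = step[OF in_C small']
    have "invertible (block_uu (G_hat A B S R P0 \<Delta>G i)) \<and> stabilizing A B (?K i)" if "i > 0" for i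
    proof -
      obtain j where j: "i = Suc j" using \<open>i > 0\<close> gr0_implies_Suc by blast
      have "stabilizing A B (?K (Suc j))"
      proof (cases j)
        case (Suc l)
        then show ?thesis
          using step'[of l "Suc l"] by (simp only: K_Suc)
      qed (use st1 in simp)
      then show ?thesis
        using step'[of j "Suc j"] by (simp only: j G_hat_Suc)
    qed
    moreover have "norm (?P i - Pstar) \<le> \<sigma> ^ i * norm (P0 - Pstar) + c * sup_norm \<Delta>G / (1 - \<sigma>)" for i
      using perturbed_contraction_bound[of \<sigma> c "\<lambda>i. norm (?P i - Pstar)" "\<lambda>i. norm (\<Delta>G i)"]
        rec \<sigma> c norm_le_sup_norm[OF \<Delta>G(1)] by (simp add: P_0)
    moreover have "\<exists>\<kappa>1\<ge>0. \<forall>i>0. norm (?K i) < \<kappa>1"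
    proof (intro exI conjI allI impI)
      define \<kappa>1 where "\<kappa>1 = max (norm (?K (Suc 0))) \<kappa> + 1"
      show "0 \<le> \<kappa>1" by (simp add: \<kappa>1_def add_increasing2 le_max_iff_disj)
      fix i :: nat assume "i > 0"
      then consider "i = Suc 0" | j where "i = Suc (Suc j)"
        by (metis not0_implies_Suc not_gr_zero)
      then show "norm (?K i) < \<kappa>1"
      proof cases
        case 2
        then have "norm (?K i) \<le> \<kappa>"
          using step'[of j "Suc j"] by (simp only: K_Suc)
        then show ?thesis by (simp add: \<kappa>1_def)
      qed (simp add: \<kappa>1_def)
    qed
    moreover have "(\<lambda>i. norm (\<Delta>G i)) \<longlonglongrightarrow> 0 \<longrightarrow> (\<lambda>i. norm (?P i - Pstar)) \<longlonglongrightarrow> 0"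
      using perturbed_contraction_tendsto_0[of \<sigma> c "\<lambda>i. norm (?P i - Pstar)" "\<lambda>i. norm (\<Delta>G i)"]
        rec \<sigma> c by simp
    ultimately show "(\<forall>i>0. invertible (block_uu (G_hat A B S R P0 \<Delta>G i)) \<and> stabilizing A B (?K i)) \<and>
      (\<forall>i. norm (?P i - Pstar) \<le> \<sigma> ^ i * norm (P0 - Pstar) + c * sup_norm \<Delta>G / (1 - \<sigma>)) \<and>
      (\<exists>\<kappa>1\<ge>0. \<forall>i>0. norm (?K i) < \<kappa>1) \<and>
      ((\<lambda>i. norm (\<Delta>G i)) \<longlonglongrightarrow> 0 \<longrightarrow> (\<lambda>i. norm (?P i - Pstar)) \<longlonglongrightarrow> 0)"
      by blast
  qed
qed

end
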